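(* Let $n\geq 8$ be an integer with $4\mid n$. Then $$\mathrm{P}\mathcal{G}_n\cong\pi(\mathcal{G}_n)=G(4,n)\cong S_4*_{D_4}D_n .$$
   Context: Let $\zeta_n=e^{2\pi i/n}$, $R_n=\mathbb{Z}[\zeta_n,1/2]$, $R_n^+=\mathbb{Z}[\zeta_n+\overline{\zeta_n},1/2]$. For a subring $R\subseteq\mathbb{C}$, $\mathrm{U}_2(R)=\{g\in \mathrm{GL}_2(R): gg^\dagger=1\}$ and $\mathrm{PU}_2(R)$ is the quotient of $\mathrm{U}_2(R)$ by its scalar matrices. $\mathrm{SO}_3(R^+)=\{g\in\mathrm{SL}_3(R^+): gg^t=1\}$. The Clifford group is $\mathcal{C}=\mathrm{U}_2(\mathbb{Z}[i,1/2])$; with $T_n=\begin{bmatrix}1&0\\0&\zeta_n\end{bmatrix}$, set $\mathcal{G}_n=\langle\mathcal{C},T_n\rangle\leq\mathrm{U}_2(R_n)$, and let $\mathrm{P}\mathcal{G}_n$ be its image in $\mathrm{PU}_2(R_n)$. The homomorphism $\pi:\mathrm{U}_2(R_n)\to\mathrm{SO}_3(R_n^+)$ sends $g$ to the matrix of $m\mapsto gmg^{-1}$ on the trace-$0$ hermitian $2\times 2$ matrices in the Pauli basis $\sigma_x=\begin{bmatrix}0&1\\1&0\end{bmatrix}$, $\sigma_y=\begin{bmatrix}0&-i\\i&0\end{bmatrix}$, $\sigma_z=\begin{bmatrix}1&0\\0&-1\end{bmatrix}$. $G(4,n)$ is the subgroup of $\mathrm{SO}_3(\mathbb{R})$ generated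 by the rotation by $\pi/2$ about the $y$-axis and the rotation by $2\pi/n$ about the $z$-axis. $S_4$ is the symmetric group on $4$ letters and $D_m$ is the dihedral group of order $2m$. In the amalgamated product, $D_4$ is embedded in $S_4$ as a subgroup of order $8$ and in $D_n$ as a standard dihedral subgroup (generated by the cyclic rotation subgroup of order $4$ and a reflection); concretely $S_4$ is the rotation group of the cube with vertices $(\pm1,\pm1,\pm1)$, $D_n$ is generated by the rotation by $2\pi/n$ about the $z$-axis and the rotation by $\pi$ about the $x$-axis, and $D_4$ is their intersection. *)

theory Defs
  imports
    "HOL-Analysis.Analysis"
    "HOL-Algebra.Algebra"
    "HOL-Algebra.Algebraic_Closure_Type"
begin

(* $ is matrix and vector indexing here *)
no_notation fps_nth (infixl \<open>$\<close> 75)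

section \<open>Rings of cyclotomic numbers\<close>

definition adjoin :: "complex set \<Rightarrow> complex set" where
  "adjoin S = generate_ring (ring_of_type_algebra :: complex ring) S"

definition zeta :: "nat \<Rightarrow> complex" where
  "zeta n = exp (2 * of_real pi * \<i> / of_nat n)"

definition Rn :: "nat \<Rightarrow> complex set" where
  "Rn n = adjoin {zeta n, 1 / 2}"

definition Rn_plus :: "nat \<Rightarrow> complex set" where
  "Rn_plus n = adjoin {zeta n + cnj (zeta n), 1 / 2}"

section \<open>Matrix groups\<close>

definition dagger :: "complex^'n^'m \<Rightarrow> complex^'m^'n" where
  "dagger g = (\<chi> i j. cnj (g $ j $ i))"

definition GL2 :: "complex set \<Rightarrow> (complex^2^2) set" where
  "GL2 R = {g. (\<forall>i j. g $ i $ j \<in> R) \<and>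
     (\<exists>h. (\<forall>i j. h $ i $ j \<in> R) \<and> g ** h = mat 1 \<and> h ** g = mat 1)}"

definition U2 :: "complex set \<Rightarrow> (complex^2^2) monoid" where
  "U2 R = \<lparr>carrier = {g \<in> GL2 R. g ** dagger g = mat 1}, mult = (**), one = mat 1\<rparr>"

definition U2_scalars :: "complex set \<Rightarrow> (complex^2^2) set" where
  "U2_scalars R = {g \<in> carrier (U2 R). \<exists>c. g = mat c}"

definition PU2 :: "complex set \<Rightarrow> (complex^2^2) set monoid" where
  "PU2 R = U2 R Mod U2_scalars R"

text \<open>The groups \<open>SO3 R\<close> are used only for rings \<open>R\<close> of real numbers, which, like all
  coefficient rings here, are regarded as subsets of the complex numbers; \<open>SO3 \<real>\<close> is the usual
  group of rotations.\<close>

definition SL3 :: "complex set \<Rightarrow> (real^3^3) set" where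
  "SL3 R = {A. (\<forall>i j. complex_of_real (A $ i $ j) \<in> R) \<and> det A = 1}"

definition SO3 :: "complex set \<Rightarrow> (real^3^3) monoid" where
  "SO3 R = \<lparr>carrier = {A \<in> SL3 R. A ** transpose A = mat 1}, mult = (**), one = mat 1\<rparr>"

section \<open>Clifford-cyclotomic groups\<close>

definition Clifford :: "(complex^2^2) set" where
  "Clifford = carrier (U2 (adjoin {\<i>, 1 / 2}))"

definition T_gate :: "nat \<Rightarrow> complex^2^2" where
  "T_gate n = vector [vector [1, 0], vector [0, zeta n]]"

definition clifford_cyclotomic :: "nat \<Rightarrow> (complex^2^2) set" where
  "clifford_cyclotomic n = generate (U2 (Rn n)) (Clifford \<union> {T_gate n})"

definition P_clifford_cyclotomic :: "nat \<Rightarrow> (complex^2^2) set monoid" where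
  "P_clifford_cyclotomic n = (PU2 (Rn n))
     \<lparr>carrier := (\<lambda>g. U2_scalars (Rn n) #>\<^bsub>U2 (Rn n)\<^esub> g) ` clifford_cyclotomic n\<rparr>"

section \<open>The conjugation representation\<close>

definition pauli_x :: "complex^2^2" where
  "pauli_x = vector [vector [0, 1], vector [1, 0]]"

definition pauli_y :: "complex^2^2" where
  "pauli_y = vector [vector [0, - \<i>], vector [\<i>, 0]]"

definition pauli_z :: "complex^2^2" where
  "pauli_z = vector [vector [1, 0], vector [0, - 1]]"

definition pauli_vec :: "real^3 \<Rightarrow> complex^2^2" where
  "pauli_vec v = v $ 1 *\<^sub>R pauli_x + v $ 2 *\<^sub>R pauli_y + v $ 3 *\<^sub>R pauli_z"

definition trace0_hermitian :: "(complex^2^2) set" where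
  "trace0_hermitian = {m. dagger m = m \<and> trace m = 0}"

text \<open>\<open>pauli_vec\<close> is the coordinate isomorphism given by the Pauli basis (see
  \<open>bij_betw_pauli_vec\<close> below), so \<open>pi_rep g\<close> is the matrix of \<open>m \<mapsto> g m g\<^sup>-\<^sup>1\<close> in that basis.\<close>

definition pi_rep :: "complex^2^2 \<Rightarrow> real^3^3" where
  "pi_rep g = matrix (\<lambda>v. the_inv pauli_vec (g ** pauli_vec v ** matrix_inv g))"

definition pi_image :: "nat \<Rightarrow> (real^3^3) monoid" where
  "pi_image n = (SO3 (Rn_plus n))\<lparr>carrier := pi_rep ` clifford_cyclotomic n\<rparr>"

section \<open>Rotation groups\<close>

definition rot_x :: "real \<Rightarrow> real^3^3" where
  "rot_x t = vector [vector [1, 0, 0],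
                     vector [0, cos t, - sin t],
                     vector [0, sin t, cos t]]"

definition rot_y :: "real \<Rightarrow> real^3^3" where
  "rot_y t = vector [vector [cos t, 0, sin t],
                     vector [0, 1, 0],
                     vector [- sin t, 0, cos t]]"

definition rot_z :: "real \<Rightarrow> real^3^3" where
  "rot_z t = vector [vector [cos t, - sin t, 0],
                     vector [sin t, cos t, 0],
                     vector [0, 0, 1]]"

definition rotation_subgroup :: "(real^3^3) set \<Rightarrow> (real^3^3) monoid" where
  "rotation_subgroup H = (SO3 \<real>)\<lparr>carrier := H\<rparr>"

definition G4 :: "nat \<Rightarrow> (real^3^3) monoid" where
  "G4 n = rotation_subgroup (generate (SO3 \<real>) {rot_y (pi / 2), rot_z (2 * pi / real n)})"

definition cube_vertices :: "(real^3) set" where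
  "cube_vertices = {v. \<forall>i. v $ i = 1 \<or> v $ i = - 1}"

definition cube_group :: "(real^3^3) monoid" where
  "cube_group = rotation_subgroup
     {A \<in> carrier (SO3 \<real>). (\<lambda>v. A *v v) ` cube_vertices = cube_vertices}"

definition dihedral_rot :: "nat \<Rightarrow> (real^3^3) monoid" where
  "dihedral_rot m = rotation_subgroup (generate (SO3 \<real>) {rot_z (2 * pi / real m), rot_x pi})"

definition cube_dihedral_inter :: "nat \<Rightarrow> (real^3^3) monoid" where
  "cube_dihedral_inter m =
     rotation_subgroup (carrier cube_group \<inter> carrier (dihedral_rot m))"

section \<open>Amalgamated products\<close>

text \<open>The product of \<open>A\<close> and \<open>B\<close> amalgamated along \<open>\<phi> : C \<rightarrow> A\<close> and \<open>\<psi> : C \<rightarrow> B\<close>: words in the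
  letters \<open>A \<squnion> B\<close> modulo the congruence that multiplies adjacent letters from the same group,
  deletes the neutral letters and identifies \<open>\<phi> c\<close> with \<open>\<psi> c\<close>.\<close>

definition amalg_words ::
  "('a, 'x) monoid_scheme \<Rightarrow> ('b, 'y) monoid_scheme \<Rightarrow> ('a + 'b) list set" where
  "amalg_words A B = lists (Inl ` carrier A \<union> Inr ` carrier B)"

inductive_set amalg_rel ::
  "('a, 'x) monoid_scheme \<Rightarrow> ('b, 'y) monoid_scheme \<Rightarrow> ('c, 'z) monoid_scheme \<Rightarrow>
   ('c \<Rightarrow> 'a) \<Rightarrow> ('c \<Rightarrow> 'b) \<Rightarrow> (('a + 'b) list \<times> ('a + 'b) list) set"
  for A :: "('a, 'x) monoid_scheme" and B :: "('b, 'y) monoid_scheme"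
    and C :: "('c, 'z) monoid_scheme" and \<phi> :: "'c \<Rightarrow> 'a" and \<psi> :: "'c \<Rightarrow> 'b"
where
  refl: "u \<in> amalg_words A B \<Longrightarrow> (u, u) \<in> amalg_rel A B C \<phi> \<psi>"
| sym: "(u, v) \<in> amalg_rel A B C \<phi> \<psi> \<Longrightarrow> (v, u) \<in> amalg_rel A B C \<phi> \<psi>"
| trans: "\<lbrakk>(u, v) \<in> amalg_rel A B C \<phi> \<psi>; (v, w) \<in> amalg_rel A B C \<phi> \<psi>\<rbrakk>
    \<Longrightarrow> (u, w) \<in> amalg_rel A B C \<phi> \<psi>"
| cong: "\<lbrakk>(u, v) \<in> amalg_rel A B C \<phi> \<psi>; p \<in> amalg_words A B; q \<in> amalg_words A B\<rbrakk>
    \<Longrightarrow> (p @ u @ q, p @ v @ q) \<in> amalg_rel A B C \<phi> \<psi>"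
| mult_l: "\<lbrakk>a \<in> carrier A; a' \<in> carrier A\<rbrakk>
    \<Longrightarrow> ([Inl a, Inl a'], [Inl (a \<otimes>\<^bsub>A\<^esub> a')]) \<in> amalg_rel A B C \<phi> \<psi>"
| mult_r: "\<lbrakk>b \<in> carrier B; b' \<in> carrier B\<rbrakk>
    \<Longrightarrow> ([Inr b, Inr b'], [Inr (b \<otimes>\<^bsub>B\<^esub> b')]) \<in> amalg_rel A B C \<phi> \<psi>"
| one_l: "([Inl \<one>\<^bsub>A\<^esub>], []) \<in> amalg_rel A B C \<phi> \<psi>"
| one_r: "([Inr \<one>\<^bsub>B\<^esub>], []) \<in> amalg_rel A B C \<phi> \<psi>"
| amalg: "c \<in> carrier C \<Longrightarrow> ([Inl (\<phi> c)], [Inr (\<psi> c)]) \<in> amalg_rel A B C \<phi> \<psi>"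

definition amalg_product ::
  "('a, 'x) monoid_scheme \<Rightarrow> ('b, 'y) monoid_scheme \<Rightarrow> ('c, 'z) monoid_scheme \<Rightarrow>
   ('c \<Rightarrow> 'a) \<Rightarrow> ('c \<Rightarrow> 'b) \<Rightarrow> ('a + 'b) list set monoid" where
  "amalg_product A B C \<phi> \<psi> =
    \<lparr>carrier = amalg_words A B // amalg_rel A B C \<phi> \<psi>,
     mult = (\<lambda>U V. (\<Union>u\<in>U. \<Union>v\<in>V. amalg_rel A B C \<phi> \<psi> `` {u @ v})),
     one = amalg_rel A B C \<phi> \<psi> `` {[]}\<rparr>"

section \<open>The definitions have the expected meaning\<close>

lemma carrier_SO3_real: "A \<in> carrier (SO3 \<real>) \<longleftrightarrow> det A = 1 \<and> A ** transpose A = mat 1"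
  by (auto simp: SO3_def SL3_def)

lemma SO3_simps [simp]: "x \<otimes>\<^bsub>SO3 R\<^esub> y = x ** y" "\<one>\<^bsub>SO3 R\<^esub> = mat 1"
  by (simp_all add: SO3_def)

lemma group_SO3_real: "group (SO3 \<real>)"
proof (rule groupI)
  fix A B assume "A \<in> carrier (SO3 \<real>)" "B \<in> carrier (SO3 \<real>)"
  then have AB: "det A = 1" "det B = 1" "A ** transpose A = mat 1" "B ** transpose B = mat 1"
    by (auto simp: carrier_SO3_real)
  have "(A ** B) ** transpose (A ** B) = A ** (B ** transpose B) ** transpose A"
    by (simp only: matrix_transpose_mul matrix_mul_assoc)
  then show "A \<otimes>\<^bsub>SO3 \<real>\<^esub> B \<in> carrier (SO3 \<real>)"
    using AB by (simp add: carrier_SO3_real det_mul)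
next
  fix A assume "A \<in> carrier (SO3 \<real>)"
  then have A: "A ** transpose A = mat 1" "det A = 1" by (auto simp: carrier_SO3_real)
  then have "transpose A ** A = mat 1" by (simp add: matrix_left_right_inverse)
  then have "transpose A \<in> carrier (SO3 \<real>)" "transpose A \<otimes>\<^bsub>SO3 \<real>\<^esub> A = \<one>\<^bsub>SO3 \<real>\<^esub>"
    using A by (auto simp: carrier_SO3_real)
  then show "\<exists>B\<in>carrier (SO3 \<real>). B \<otimes>\<^bsub>SO3 \<real>\<^esub> A = \<one>\<^bsub>SO3 \<real>\<^esub>" by blast
qed (auto simp: carrier_SO3_real matrix_mul_assoc)

lemmas pauli_defs = pauli_vec_def pauli_x_def pauli_y_def pauli_z_def

lemma bij_betw_pauli_vec: "bij_betw pauli_vec UNIV trace0_hermitian"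
proof (rule bij_betwI[where g = "\<lambda>m. vector [Re (m $ 1 $ 2), - Im (m $ 1 $ 2), Re (m $ 1 $ 1)]"])
  show "pauli_vec \<in> UNIV \<rightarrow> trace0_hermitian"
    by (simp add: pauli_defs trace0_hermitian_def dagger_def trace_def sum_2 vec_eq_iff forall_2
        complex_eq_iff)
next
  fix m assume "m \<in> trace0_hermitian"
  then have d: "dagger m = m" and t: "m $ 1 $ 1 + m $ 2 $ 2 = 0"
    by (auto simp: trace0_hermitian_def trace_def sum_2)
  from d have "cnj (m $ j $ i) = m $ i $ j" for i j
    by (simp add: dagger_def vec_eq_iff)
  from this[of 1 1] this[of 1 2] this[of 2 2] t
  show "pauli_vec (vector [Re (m $ 1 $ 2), - Im (m $ 1 $ 2), Re (m $ 1 $ 1)]) = m"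
    by (simp add: pauli_defs vec_eq_iff forall_2 complex_eq_iff)
qed (auto simp: pauli_defs vec_eq_iff forall_3)

lemma dagger_mult: "dagger (A ** B) = dagger B ** dagger A"
  by (simp add: dagger_def matrix_matrix_mult_def vec_eq_iff cnj_sum mult.commute)

lemma dagger_dagger [simp]: "dagger (dagger A) = A"
  by (simp add: dagger_def vec_eq_iff)

lemma matrix_inv_unitary:
  fixes g :: "complex^2^2"
  assumes "g ** dagger g = mat 1"
  shows "matrix_inv g = dagger g"
proof -
  have "dagger g ** g = mat 1"
    using assms by (simp add: matrix_left_right_inverse)
  then show ?thesis
    using assms unfolding matrix_inv_def
    by (intro some_equality) (simp, metis matrix_mul_assoc matrix_mul_lid matrix_mul_rid)
qed

lemma matrix_mult_linear:
  fixes g h a b :: "complex^2^2"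
  shows "g ** (a + b) ** h = g ** a ** h + g ** b ** h"
    and "g ** (c *\<^sub>R a) ** h = c *\<^sub>R (g ** a ** h)"
  by (simp_all add: matrix_matrix_mult_def vec_eq_iff sum_2 algebra_simps)

lemma pauli_vec_linear: "linear pauli_vec"
  by (rule linearI) (simp_all add: pauli_vec_def algebra_simps)

lemma pauli_vec_pi_rep:
  assumes "g ** dagger g = mat 1"
  shows "pauli_vec (pi_rep g *v v) = g ** pauli_vec v ** matrix_inv g"
proof -
  define f where "f = (\<lambda>v. the_inv pauli_vec (g ** pauli_vec v ** matrix_inv g))"
  have inj: "inj pauli_vec" and ran: "range pauli_vec = trace0_hermitian"
    using bij_betw_pauli_vec by (auto simp: bij_betw_def)
  have inv: "matrix_inv g = dagger g" "dagger g ** g = mat 1"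
    using assms matrix_inv_unitary by (auto simp: matrix_left_right_inverse)
  have "g ** pauli_vec v ** matrix_inv g \<in> trace0_hermitian" for v
  proof -
    have "pauli_vec v \<in> trace0_hermitian" using ran by blast
    then have v: "dagger (pauli_vec v) = pauli_vec v" "trace (pauli_vec v) = 0"
      by (auto simp: trace0_hermitian_def)
    have "trace ((g ** pauli_vec v) ** dagger g) = trace (dagger g ** (g ** pauli_vec v))"
      by (rule trace_mul_sym)
    also have "\<dots> = 0"
      using v inv by (simp add: matrix_mul_assoc)
    finally show ?thesis
      using v by (simp add: trace0_hermitian_def inv dagger_mult matrix_mul_assoc)
  qed
  then have f: "pauli_vec (f v) = g ** pauli_vec v ** matrix_inv g" for v
    unfolding f_def using inj ran by (simp add: f_the_inv_into_f)
  have "linear f"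
  proof (rule linearI)
    fix x y
    have "pauli_vec (f (x + y)) = pauli_vec (f x + f y)"
      by (simp add: f linear_add[OF pauli_vec_linear] matrix_mult_linear)
    then show "f (x + y) = f x + f y" using inj by (simp add: inj_eq)
  next
    fix c x
    have "pauli_vec (f (c *\<^sub>R x)) = pauli_vec (c *\<^sub>R f x)"
      by (simp add: f linear_scale[OF pauli_vec_linear] matrix_mult_linear)
    then show "f (c *\<^sub>R x) = c *\<^sub>R f x" using inj by (simp add: inj_eq)
  qed
  then show ?thesis
    using f by (simp add: pi_rep_def matrix_works flip: f_def)
qed

lemma pi_rep_mult:
  assumes "g ** dagger g = mat 1" "h ** dagger h = mat 1"
  shows "pi_rep (g ** h) = pi_rep g ** pi_rep h"
proof -
  have gh: "(g ** h) ** dagger (g ** h) = mat 1"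
    by (metis assms dagger_mult matrix_mul_assoc matrix_mul_rid)
  have "pauli_vec (pi_rep (g ** h) *v v) = pauli_vec ((pi_rep g ** pi_rep h) *v v)" for v
    using assms gh
    by (simp add: pauli_vec_pi_rep matrix_inv_unitary dagger_mult matrix_mul_assoc
        flip: matrix_vector_mul_assoc)
  then have "pi_rep (g ** h) *v v = (pi_rep g ** pi_rep h) *v v" for v
    using bij_betw_pauli_vec by (metis bij_betw_imp_inj_on injD)
  then show ?thesis by (simp add: matrix_eq)
qed

lemma amalg_words_append [simp]:
  "u @ v \<in> amalg_words A B \<longleftrightarrow> u \<in> amalg_words A B \<and> v \<in> amalg_words A B"
  by (auto simp: amalg_words_def)

context
  fixes A :: "('a, 'x) monoid_scheme" and B :: "('b, 'y) monoid_scheme"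
    and C :: "('c, 'z) monoid_scheme" and \<phi> :: "'c \<Rightarrow> 'a" and \<psi> :: "'c \<Rightarrow> 'b"
  assumes A: "group A" and B: "group B"
    and \<phi>: "\<phi> \<in> carrier C \<rightarrow> carrier A" and \<psi>: "\<psi> \<in> carrier C \<rightarrow> carrier B"
begin

interpretation A: group A by (rule A)
interpretation B: group B by (rule B)

private abbreviation (input) "W \<equiv> amalg_words A B"
private abbreviation (input) "E \<equiv> amalg_rel A B C \<phi> \<psi>"
private abbreviation (input) "P \<equiv> amalg_product A B C \<phi> \<psi>"

lemma amalg_rel_words: "(u, v) \<in> E \<Longrightarrow> u \<in> W \<and> v \<in> W"
proof (induction rule: amalg_rel.induct)
  case (amalg c)
  then show ?case using \<phi> \<psi> by (auto simp: amalg_words_def)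
qed (auto simp: amalg_words_def)

lemma equiv_amalg_rel: "equiv W E"
proof (rule equivI)
  show "E \<subseteq> W \<times> W" using amalg_rel_words by auto
qed (auto simp: refl_on_def sym_def trans_def intro: amalg_rel.intros)

lemma amalg_rel_append:
  assumes "(u, u') \<in> E" "(v, v') \<in> E" shows "(u @ v, u' @ v') \<in> E"
proof -
  have "u \<in> W" "u' \<in> W" "v \<in> W" "v' \<in> W" "[] \<in> W"
    using assms amalg_rel_words by (auto simp: amalg_words_def)
  then show ?thesis
    using amalg_rel.cong[OF assms(1), of "[]" v] amalg_rel.cong[OF assms(2), of u' "[]"]
    by (auto intro: amalg_rel.trans)
qed

lemma amalg_mult_class:
  assumes "u \<in> W" "v \<in> W"
  shows "E `` {u} \<otimes>\<^bsub>P\<^esub> E `` {v} = E `` {u @ v}"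
proof -
  have "(\<Union>x\<in>E `` {u}. \<Union>y\<in>E `` {v}. E `` {x @ y}) = E `` {u @ v}"
    using equiv_amalg_rel equiv_amalg_rel _ assms
  proof (rule UN_equiv_class2)
    show "congruent2 E E (\<lambda>x y. E `` {x @ y})"
      by (auto simp: congruent2_def intro!: equiv_class_eq[OF equiv_amalg_rel] amalg_rel_append)
  qed
  then show ?thesis by (simp add: amalg_product_def)
qed

lemma amalg_inverse: "u \<in> W \<Longrightarrow> \<exists>v\<in>W. (v @ u, []) \<in> E"
proof (induction u)
  case Nil
  then show ?case by (auto intro: amalg_rel.refl)
next
  case (Cons x u)
  then have u: "u \<in> W" "[x] \<in> W" and x: "x \<in> Inl ` carrier A \<union> Inr ` carrier B"
    by (auto simp: amalg_words_def)
  obtain v where v: "v \<in> W" "(v @ u, []) \<in> E" using Cons u by blast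
  obtain y where y: "[y] \<in> W" "([y, x], []) \<in> E"
  proof (cases x)
    case (Inl a)
    with x have "a \<in> carrier A" by auto
    then have "([Inl (inv\<^bsub>A\<^esub> a), Inl a], [Inl \<one>\<^bsub>A\<^esub>]) \<in> E"
      using amalg_rel.mult_l[of "inv\<^bsub>A\<^esub> a" A a] by simp
    then show ?thesis
      using Inl \<open>a \<in> carrier A\<close>
      by (intro that[of "Inl (inv\<^bsub>A\<^esub> a)"]) (auto simp: amalg_words_def intro: amalg_rel.intros)
  next
    case (Inr b)
    with x have "b \<in> carrier B" by auto
    then have "([Inr (inv\<^bsub>B\<^esub> b), Inr b], [Inr \<one>\<^bsub>B\<^esub>]) \<in> E"
      using amalg_rel.mult_r[of "inv\<^bsub>B\<^esub> b" B b] by simp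
    then show ?thesis
      using Inr \<open>b \<in> carrier B\<close>
      by (intro that[of "Inr (inv\<^bsub>B\<^esub> b)"]) (auto simp: amalg_words_def intro: amalg_rel.intros)
  qed
  have "(v @ [y, x] @ u, v @ [] @ u) \<in> E"
    using amalg_rel.cong y v u by blast
  then have "((v @ [y]) @ x # u, []) \<in> E"
    using v by (auto intro: amalg_rel.trans)
  then show ?case using v y by (intro bexI[of _ "v @ [y]"]) auto
qed

lemma group_amalg_product: "group P"
proof (rule groupI)
  have carr: "carrier P = W // E" by (simp add: amalg_product_def)
  have one: "\<one>\<^bsub>P\<^esub> = E `` {[]}" by (simp add: amalg_product_def)
  have nil: "[] \<in> W" by (simp add: amalg_words_def)
  show "\<one>\<^bsub>P\<^esub> \<in> carrier P" using nil by (auto simp: carr one intro: quotientI)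
  fix U assume "U \<in> carrier P"
  then obtain u where u: "u \<in> W" "U = E `` {u}" by (auto simp: carr elim: quotientE)
  show "\<one>\<^bsub>P\<^esub> \<otimes>\<^bsub>P\<^esub> U = U" using u nil by (simp add: one amalg_mult_class)
  obtain v where v: "v \<in> W" "(v @ u, []) \<in> E" using amalg_inverse u by blast
  then have "E `` {v} \<otimes>\<^bsub>P\<^esub> U = \<one>\<^bsub>P\<^esub>"
    using u by (simp add: one amalg_mult_class equiv_class_eq[OF equiv_amalg_rel])
  then show "\<exists>V\<in>carrier P. V \<otimes>\<^bsub>P\<^esub> U = \<one>\<^bsub>P\<^esub>"
    using v by (auto simp: carr intro: quotientI)
  fix V assume "V \<in> carrier P"
  then obtain v where v: "v \<in> W" "V = E `` {v}" by (auto simp: carr elim: quotientE)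
  show "U \<otimes>\<^bsub>P\<^esub> V \<in> carrier P"
    using u v by (auto simp: carr amalg_mult_class intro: quotientI)
  fix T assume "T \<in> carrier P"
  then obtain w where w: "w \<in> W" "T = E `` {w}" by (auto simp: carr elim: quotientE)
  show "U \<otimes>\<^bsub>P\<^esub> V \<otimes>\<^bsub>P\<^esub> T = U \<otimes>\<^bsub>P\<^esub> (V \<otimes>\<^bsub>P\<^esub> T)"
    using u v w by (simp add: amalg_mult_class)
qed

lemma amalg_product_universal:
  assumes G: "group G" and f: "f \<in> hom A G" and g: "g \<in> hom B G"
    and fg: "\<And>c. c \<in> carrier C \<Longrightarrow> f (\<phi> c) = g (\<psi> c)"
  shows "\<exists>h\<in>hom P G. (\<forall>a\<in>carrier A. h (E `` {[Inl a]}) = f a) \<and>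
                     (\<forall>b\<in>carrier B. h (E `` {[Inr b]}) = g b)"
proof -
  interpret G: group G by (rule G)
  define k where "k = (\<lambda>u. foldr (\<lambda>x y. case_sum f g x \<otimes>\<^bsub>G\<^esub> y) u \<one>\<^bsub>G\<^esub>)"
  have f': "f a \<in> carrier G" if "a \<in> carrier A" for a using f that by (auto simp: hom_def)
  have g': "g b \<in> carrier G" if "b \<in> carrier B" for b using g that by (auto simp: hom_def)
  have kc: "k u \<in> carrier G" if "u \<in> W" for u
    using that by (induction u) (auto simp: k_def amalg_words_def f' g')
  have kapp: "k (u @ v) = k u \<otimes>\<^bsub>G\<^esub> k v" if "u \<in> W" "v \<in> W" for u v
    using that(1)
  proof (induction u)
    case Nil
    then show ?case using kc[OF that(2)] by (simp add: k_def)
  next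
    case (Cons x u)
    then have "u \<in> W" "case_sum f g x \<in> carrier G" "k (u @ v) = k u \<otimes>\<^bsub>G\<^esub> k v"
      by (auto simp: amalg_words_def f' g')
    then show ?case using kc[OF that(2)] kc[of u] by (simp add: k_def G.m_assoc)
  qed
  have kE: "k u = k v" if "(u, v) \<in> E" for u v
    using that
  proof (induction rule: amalg_rel.induct)
    case (cong u v p q)
    then show ?case using amalg_rel_words[OF cong.hyps(1)] by (simp add: kapp)
  next
    case one_l
    then show ?case
      using hom_one[OF f A G] by (simp add: k_def)
  next
    case one_r
    then show ?case
      using hom_one[OF g B G] by (simp add: k_def)
  qed (use \<phi> \<psi> in \<open>auto simp: k_def f' g' fg hom_mult[OF f] hom_mult[OF g] G.m_assoc\<close>)
  define h where "h = (\<lambda>U. the_elem (k ` U))"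
  have h: "h (E `` {u}) = k u" if "u \<in> W" for u
  proof -
    have "k ` (E `` {u}) = {k u}"
      using kE that by (auto intro: amalg_rel.refl)
    then show ?thesis by (simp add: h_def)
  qed
  have "h \<in> hom P G"
  proof (rule homI)
    fix U assume "U \<in> carrier P"
    then obtain u where u: "u \<in> W" "U = E `` {u}"
      by (auto simp: amalg_product_def elim: quotientE)
    then show "h U \<in> carrier G" by (simp add: h kc)
    fix V assume "V \<in> carrier P"
    then obtain v where v: "v \<in> W" "V = E `` {v}"
      by (auto simp: amalg_product_def elim: quotientE)
    show "h (U \<otimes>\<^bsub>P\<^esub> V) = h U \<otimes>\<^bsub>G\<^esub> h V"
      using u v by (simp add: amalg_mult_class h kapp)
  qed
  moreover have "h (E `` {[Inl a]}) = f a" if "a \<in> carrier A" for a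
    using that by (subst h) (auto simp: amalg_words_def k_def f')
  moreover have "h (E `` {[Inr b]}) = g b" if "b \<in> carrier B" for b
    using that by (subst h) (auto simp: amalg_words_def k_def g')
  ultimately show ?thesis by blast
qed

end


lemma matrix3_eq_iff:
  "(A :: real^3^3) = B \<longleftrightarrow>
    A $ 1 $ 1 = B $ 1 $ 1 \<and> A $ 1 $ 2 = B $ 1 $ 2 \<and> A $ 1 $ 3 = B $ 1 $ 3 \<and>
    A $ 2 $ 1 = B $ 2 $ 1 \<and> A $ 2 $ 2 = B $ 2 $ 2 \<and> A $ 2 $ 3 = B $ 2 $ 3 \<and>
    A $ 3 $ 1 = B $ 3 $ 1 \<and> A $ 3 $ 2 = B $ 3 $ 2 \<and> A $ 3 $ 3 = B $ 3 $ 3"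
  by (auto simp: vec_eq_iff forall_3)


text \<open>\<open>S\<^sub>4\<close> acts on the four diagonals of the cube, spanned by the vectors \<open>diagonal i\<close>.\<close>

definition diagonal :: "nat \<Rightarrow> real^3" where
  "diagonal i = (if i = 1 then vector [1, 1, 1] else if i = 2 then vector [1, - 1, - 1]
     else if i = 3 then vector [- 1, 1, - 1] else vector [- 1, - 1, 1])"

definition diagonal_perm :: "(nat \<Rightarrow> nat) \<Rightarrow> real^3^3" where
  "diagonal_perm p = (\<chi> a b. (\<Sum>i\<in>{1..4}. diagonal (p i) $ a * diagonal i $ b) / 4)"

lemma atLeastAtMost_1_4: "{1..4} = {1, 2, 3, 4::nat}" "{Suc 0..4} = {Suc 0, 2, 3, 4}"
  by auto

lemma matrix_eq_diagonals:
  assumes "\<And>i. i \<in> {1..4} \<Longrightarrow> A *v diagonal i = B *v diagonal i"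
  shows "(A :: real^3^3) = B"
  using assms[of 1] assms[of 2] assms[of 3] assms[of 4]
  by (simp add: matrix3_eq_iff diagonal_def vec_eq_iff forall_3 matrix_vector_mult_def sum_3)

lemma diagonal_perm_apply:
  assumes p: "p permutes {1..4}" and i: "i \<in> {1..4}"
  shows "diagonal_perm p *v diagonal i = diagonal (p i)"
proof -
  have s: "(\<Sum>j\<in>{1..4}. diagonal (p j) $ a) = 0" for a
  proof -
    have "(\<Sum>j\<in>{1..4}. diagonal (p j) $ a) = (\<Sum>j\<in>{1..4}. diagonal j $ a)"
      using sum.permute[OF p, of "\<lambda>j. diagonal j $ a"] by (simp add: comp_def)
    also have "\<dots> = 0"
      using exhaust_3[of a] by (auto simp: atLeastAtMost_1_4 diagonal_def)
    finally show ?thesis .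
  qed
  show ?thesis
    unfolding vec_eq_iff
  proof
    fix a
    show "(diagonal_perm p *v diagonal i) $ a = diagonal (p i) $ a"
      using i s[of a]
      by (auto simp: diagonal_perm_def matrix_vector_mult_def sum_3 atLeastAtMost_1_4
          diagonal_def[of "Suc 0"] diagonal_def[of 1] diagonal_def[of 2] diagonal_def[of 3]
          diagonal_def[of 4]) (simp_all add: field_simps)
  qed
qed

lemma diagonal_perm_comp:
  assumes "p permutes {1..4}" "q permutes {1..4}"
  shows "diagonal_perm (p \<circ> q) = diagonal_perm p ** diagonal_perm q"
proof (rule matrix_eq_diagonals)
  fix i :: nat assume i: "i \<in> {1..4}"
  then have "q i \<in> {1..4}" using assms(2) by (simp only: permutes_in_image)
  then show "diagonal_perm (p \<circ> q) *v diagonal i = diagonal_perm p ** diagonal_perm q *v diagonal i"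
    using assms i
    by (simp add: diagonal_perm_apply permutes_compose flip: matrix_vector_mul_assoc)
qed

lemma diagonal_perm_orthogonal:
  assumes p: "p permutes {1..4}"
  shows "diagonal_perm p ** transpose (diagonal_perm p) = mat 1"
proof -
  have q: "inv' p permutes {1..4}" using p by (rule permutes_inv)
  have "transpose (diagonal_perm p) = diagonal_perm (inv' p)"
  proof -
    have "(\<Sum>i\<in>{1..4}. diagonal (p i) $ b * diagonal i $ a) =
        (\<Sum>i\<in>{1..4}. diagonal (inv' p i) $ a * diagonal i $ b)" for a b
      using sum.permute[OF p, of "\<lambda>i. diagonal (inv' p i) $ a * diagonal i $ b"]
      by (simp add: comp_def permutes_inverses[OF p] mult.commute)
    then show ?thesis
      by (simp add: transpose_def diagonal_perm_def vec_eq_iff)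
  qed
  then have "diagonal_perm p ** transpose (diagonal_perm p) = diagonal_perm id"
    by (simp add: permutes_inv_o[OF p] flip: diagonal_perm_comp[OF p q])
  also have "\<dots> = mat 1"
    by (rule matrix_eq_diagonals) (simp add: diagonal_perm_apply permutes_id)
  finally show ?thesis .
qed

lemma det_diagonal_perm:
  assumes "p permutes {1..4}"
  shows "det (diagonal_perm p) = 1 \<or> det (diagonal_perm p) = - 1"
  using diagonal_perm_orthogonal[OF assms]
  by (metis det_I det_mul det_transpose square_eq_1_iff)

lemma cube_vertices_diagonal:
  "v \<in> cube_vertices \<longleftrightarrow> (\<exists>i\<in>{1..4}. v = diagonal i \<or> v = - diagonal i)"
  by (auto simp: cube_vertices_def forall_3 atLeastAtMost_1_4 diagonal_def vec_eq_iff)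

lemma diagonal_inj:
  assumes "i \<in> {1..4}" "j \<in> {1..4}" "c \<in> {1, - 1}" "d \<in> {1, - 1}"
    "c *\<^sub>R diagonal i = d *\<^sub>R diagonal j"
  shows "i = j \<and> c = d"
  using assms by (auto simp: atLeastAtMost_1_4 diagonal_def vec_eq_iff forall_3)

lemma det_scaleR3: "det (c *\<^sub>R (A :: real^3^3)) = c ^ 3 * det A"
  by (simp add: det_3 power3_eq_cube algebra_simps)

lemma sym_group_4_iso_cube_group: "sym_group 4 \<cong> cube_group"
proof -
  define F where "F p = det (diagonal_perm p) *\<^sub>R diagonal_perm p" for p
  have carr: "carrier (sym_group 4) = {p. p permutes {1..4}}" by (simp add: sym_group_def)
  have F_apply: "F p *v diagonal i = det (diagonal_perm p) *\<^sub>R diagonal (p i)"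
    if "p permutes {1..4}" "i \<in> {1..4}" for p i
    using diagonal_perm_apply[OF that]
    by (simp add: F_def flip: scaleR_matrix_vector_assoc)
  have F_in: "F p \<in> carrier cube_group" if p: "p permutes {1..4}" for p
  proof -
    have det: "det (diagonal_perm p) = 1 \<or> det (diagonal_perm p) = - 1"
      by (rule det_diagonal_perm[OF p])
    have "F p ** transpose (F p) = mat 1"
    proof -
      have "F p = diagonal_perm p \<or> F p = - diagonal_perm p"
        using det by (auto simp: F_def)
      moreover have "(- diagonal_perm p) ** transpose (- diagonal_perm p) =
          diagonal_perm p ** transpose (diagonal_perm p)"
        by (simp add: matrix_matrix_mult_def transpose_def vec_eq_iff)
      ultimately show ?thesis using diagonal_perm_orthogonal[OF p] by auto
    qed
    moreover have "det (F p) = 1"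
      using det by (auto simp: F_def det_scaleR3)
    ultimately have SO3: "F p \<in> carrier (SO3 \<real>)" by (simp add: carrier_SO3_real)
    have "(\<lambda>v. F p *v v) ` cube_vertices \<subseteq> cube_vertices"
    proof clarify
      fix v assume "v \<in> cube_vertices"
      then obtain i where i: "i \<in> {1..4}" "v = diagonal i \<or> v = - diagonal i"
        by (auto simp: cube_vertices_diagonal)
      have "p i \<in> {1..4}" using p i by (simp only: permutes_in_image)
      moreover have "F p *v v = diagonal (p i) \<or> F p *v v = - diagonal (p i)"
        using i det F_apply[OF p i(1)] by (auto simp: linear_neg[OF matrix_vector_mul_linear])
      ultimately show "F p *v v \<in> cube_vertices"
        using cube_vertices_diagonal by blast
    qed
    moreover have "finite cube_vertices"
    proof -
      have "cube_vertices \<subseteq> diagonal ` {1..4} \<union> (\<lambda>i. - diagonal i) ` {1..4}"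
        using cube_vertices_diagonal by blast
      then show ?thesis by (rule finite_subset) simp
    qed
    moreover have "inj_on (\<lambda>v. F p *v v) cube_vertices"
    proof (rule inj_onI)
      fix x y assume "F p *v x = F p *v y"
      moreover have "transpose (F p) ** F p = mat 1"
        using \<open>F p ** transpose (F p) = mat 1\<close> by (simp add: matrix_left_right_inverse)
      ultimately show "x = y"
        by (metis matrix_vector_mul_assoc matrix_vector_mul_lid)
    qed
    ultimately have "(\<lambda>v. F p *v v) ` cube_vertices = cube_vertices"
      by (simp add: endo_inj_surj)
    with SO3 show ?thesis by (simp add: cube_group_def rotation_subgroup_def)
  qed
  have "F \<in> hom (sym_group 4) cube_group"
  proof (rule homI)
    fix p q assume "p \<in> carrier (sym_group 4)" "q \<in> carrier (sym_group 4)"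
    then have pq: "p permutes {1..4}" "q permutes {1..4}" by (simp_all add: carr)
    have "(c *\<^sub>R A) ** (d *\<^sub>R B) = (c * d) *\<^sub>R (A ** B)" for c d and A B :: "real^3^3"
      by (simp add: matrix_matrix_mult_def vec_eq_iff sum_distrib_left mult_ac)
    then show "F (p \<otimes>\<^bsub>sym_group 4\<^esub> q) = F p \<otimes>\<^bsub>cube_group\<^esub> F q"
      using pq
      by (simp add: F_def sym_group_mult cube_group_def rotation_subgroup_def SO3_def
          diagonal_perm_comp det_mul)
  qed (simp add: carr F_in)
  moreover have "inj_on F (carrier (sym_group 4))"
  proof (rule inj_onI)
    fix p q assume "p \<in> carrier (sym_group 4)" "q \<in> carrier (sym_group 4)" and eq: "F p = F q"
    then have pq: "p permutes {1..4}" "q permutes {1..4}" by (simp_all add: carr)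
    show "p = q"
    proof
      fix i
      show "p i = q i"
      proof (cases "i \<in> {1..4}")
        case True
        have "p i \<in> {1..4}" "q i \<in> {1..4}" using pq True by (simp_all only: permutes_in_image)
        moreover have "det (diagonal_perm p) *\<^sub>R diagonal (p i) = det (diagonal_perm q) *\<^sub>R diagonal (q i)"
          using F_apply[OF pq(1) True] F_apply[OF pq(2) True] eq by simp
        ultimately show ?thesis
          using diagonal_inj det_diagonal_perm[OF pq(1)] det_diagonal_perm[OF pq(2)] by blast
      next
        case False
        then show ?thesis using permutes_not_in[OF pq(1)] permutes_not_in[OF pq(2)] by metis
      qed
    qed
  qed
  moreover have "A \<in> F ` carrier (sym_group 4)" if "A \<in> carrier cube_group" for A
  proof -
    have A: "det A = 1" "A ** transpose A = mat 1"
      and AV: "(\<lambda>v. A *v v) ` cube_vertices = cube_vertices"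
      using that by (auto simp: cube_group_def rotation_subgroup_def carrier_SO3_real)
    have "\<exists>j\<in>{1..4}. \<exists>c\<in>{1, - 1}. A *v diagonal i = c *\<^sub>R diagonal j" if "i \<in> {1..4}" for i
    proof -
      have "diagonal i \<in> cube_vertices" using that cube_vertices_diagonal by blast
      then have "A *v diagonal i \<in> cube_vertices" using AV by blast
      then obtain j where "j \<in> {1..4}" "A *v diagonal i = diagonal j \<or> A *v diagonal i = - diagonal j"
        using cube_vertices_diagonal by blast
      then show ?thesis by (intro bexI[of _ j]) auto
    qed
    then obtain p c where pc: "\<And>i. i \<in> {1..4} \<Longrightarrow>
        p i \<in> {1..4} \<and> c i \<in> {1, - 1} \<and> A *v diagonal i = c i *\<^sub>R diagonal (p i)"
      by metis
    have inj: "inj_on p {1..4}"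
    proof (rule inj_onI)
      fix i j assume ij: "i \<in> {1..4}" "j \<in> {1..4}" "p i = p j"
      define d where "d = c i * c j"
      have d: "d \<in> {1, - 1}" using pc[OF ij(1)] pc[OF ij(2)] by (auto simp: d_def)
      have "A *v diagonal i = d *\<^sub>R (A *v diagonal j)"
        using pc[OF ij(1)] pc[OF ij(2)] ij by (auto simp: d_def)
      then have "A *v diagonal i = A *v (d *\<^sub>R diagonal j)"
        by (simp add: matrix_vector_mult_scaleR)
      moreover have "transpose A ** A = mat 1"
        using A by (simp add: matrix_left_right_inverse)
      ultimately have "1 *\<^sub>R diagonal i = d *\<^sub>R diagonal j"
        by (metis matrix_vector_mul_assoc matrix_vector_mul_lid scaleR_one)
      then show "i = j" using diagonal_inj[of i j 1 d] ij d by simp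
    qed
    then have im: "p ` {1..4} = {1..4}"
      using pc by (intro endo_inj_surj) auto
    define q where "q i = (if i \<in> {1..4} then p i else i)" for i
    have q: "q permutes {1..4}"
    proof (rule bij_imp_permutes)
      show "bij_betw q {1..4} {1..4}"
        using inj im by (auto simp: bij_betw_def q_def inj_on_def image_def)
    qed (auto simp: q_def)
    define e where "e j = c (inv' q j)" for j
    have "(\<Sum>j\<in>{1..4}. e j *\<^sub>R diagonal j) = (\<Sum>i\<in>{1..4}. e (q i) *\<^sub>R diagonal (q i))"
      using sum.permute[OF q, of "\<lambda>j. e j *\<^sub>R diagonal j"] by (simp add: comp_def)
    also have "\<dots> = (\<Sum>i\<in>{1..4}. A *v diagonal i)"
    proof (rule sum.cong)
      fix i :: nat assume "i \<in> {1..4}"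
      then show "e (q i) *\<^sub>R diagonal (q i) = A *v diagonal i"
        using pc[of i] permutes_inverses(2)[OF q, of i] unfolding e_def by (simp add: q_def)
    qed simp
    also have "\<dots> = A *v (\<Sum>i\<in>{1..4}. diagonal i)"
      by (simp add: linear_sum[OF matrix_vector_mul_linear])
    also have "(\<Sum>i\<in>{1..4}. diagonal i) = 0"
      by (simp add: atLeastAtMost_1_4 diagonal_def vec_eq_iff forall_3)
    finally have "(\<Sum>j\<in>{1..4}. e j *\<^sub>R diagonal j) = 0" by simp
    then have e: "e 1 = e 2" "e 2 = e 3" "e 3 = e 4"
      by (auto simp: atLeastAtMost_1_4 diagonal_def vec_eq_iff forall_3)
    have "A *v diagonal i = (e 1 *\<^sub>R diagonal_perm q) *v diagonal i" if i: "i \<in> {1..4}" for i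
    proof -
      have "q i \<in> {1..4}" using q i by (simp only: permutes_in_image)
      then have "e (q i) = e 1" using e by (auto simp: atLeastAtMost_1_4)
      moreover have "e (q i) = c i" by (simp add: e_def permutes_inverses[OF q])
      ultimately show ?thesis
        using pc[OF i] i diagonal_perm_apply[OF q i]
        by (simp add: q_def flip: scaleR_matrix_vector_assoc)
    qed
    then have Ae: "A = e 1 *\<^sub>R diagonal_perm q" by (rule matrix_eq_diagonals)
    have "e 1 \<in> {1, - 1}"
    proof -
      have "inv' q 1 \<in> {1..4}" using permutes_inv[OF q] by (simp only: permutes_in_image) simp
      then show ?thesis using pc by (simp add: e_def)
    qed
    then have "e 1 = det (diagonal_perm q)"
      using A(1) det_diagonal_perm[OF q] by (auto simp: Ae det_scaleR3)
    then show ?thesis using Ae q by (auto simp: F_def carr)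
  qed
  ultimately have "F \<in> iso (sym_group 4) cube_group"
    using F_in by (auto simp: iso_iff carr)
  then show ?thesis by (rule is_isoI)
qed


end

(*
  The group P G_n is isomorphic to pi(G_n) because the kernel of pi consists of the scalar matrices.
  The matrices in pi(C) have dyadic entries, and a sum of three squares equal to 4^k has all its
  terms divisible by 4^k, so pi(C) consists of signed permutation matrices; together with
  pi(T_n) = rot_z(2 pi / n) this gives G(4,n).

  For the amalgam, work modulo an ideal above 2 in a ring of cyclotomic numbers with odd
  denominators. If d in D_n rotates about the z-axis by an angle t that is not a multiple of pi/2,
  then 1 / cos t = 0 and tan t = 1 modulo the ideal, hence d / cos t = u u^T with u = (1,1,0). An
  element a of S_4 outside D_4 moves the z-axis, so modulo 2 it permutes the coordinates in such a
  way that u^T a u = 1. Hence an alternating product of such elements, divided by the product of the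
  cosines, sends some integral vector to u modulo the ideal. If the product were in S_4, the image
  would be integral multiplied by an element of the ideal, thus 0 modulo the ideal.
*)
theory Submission
  imports Defs
begin

text \<open>The contradiction needs one proper ideal that contains 1 / cos t and tan t - 1 for all
  the angles t at once, and this dictates the ring. With z = e^(i t) one has 1 / cos t = 2 z / (1 +
  z^2). If the order of -z^2 is a power of 2, then 2 / (1 + z^2) is only nilpotent modulo 2, so the
  ideal (2) is replaced by its radical. If the order is an odd prime power, then 1 + z^2 is a
  divisor of an odd prime and not a unit of the cyclotomic integers, which is why odd integers are
  inverted.

  Modulo the ideal d / cos t has rank one, so all that it sees of a vector y is u^T y. The induction
  along a product therefore switches between two conditions: y = u after a dihedral letter, and u^T
  y = 1 after a cube letter.

  The products under study start with a letter of D_n and end with one of S_4. In a general word a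
  further letter of S_4 stands in front; moved to the other side of an equation, it turns "is not 1"
  into "is not in S_4".\<close>

section \<open>Cyclotomic numbers modulo 2\<close>

text \<open>For n > 0 this is Z[zeta_n]. Subtraction is the only closure rule: the roots of unity
  are closed under multiplication, so the additive group that they span is already a ring.\<close>

inductive_set cyclotomic_span :: "nat \<Rightarrow> complex set" for n where
  root: "z ^ n = 1 \<Longrightarrow> z \<in> cyclotomic_span n"
| diff: "x \<in> cyclotomic_span n \<Longrightarrow> y \<in> cyclotomic_span n \<Longrightarrow> x - y \<in> cyclotomic_span n"

lemma cyclotomic_span_one [simp]: "1 \<in> cyclotomic_span n"
  by (rule cyclotomic_span.root) simp

lemma cyclotomic_span_zero [simp]: "0 \<in> cyclotomic_span n"
  using cyclotomic_span.diff[OF cyclotomic_span_one cyclotomic_span_one] by simp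

lemma cyclotomic_span_minus [intro]: "x \<in> cyclotomic_span n \<Longrightarrow> - x \<in> cyclotomic_span n"
  using cyclotomic_span.diff[OF cyclotomic_span_zero] by simp

lemma cyclotomic_span_add [intro]:
  "x \<in> cyclotomic_span n \<Longrightarrow> y \<in> cyclotomic_span n \<Longrightarrow> x + y \<in> cyclotomic_span n"
  using cyclotomic_span.diff[OF _ cyclotomic_span_minus] by force

lemma cyclotomic_span_mult [intro]:
  assumes "x \<in> cyclotomic_span n" "y \<in> cyclotomic_span n"
  shows "x * y \<in> cyclotomic_span n"
  using assms
proof (induction x)
  case (root z)
  from root(2,1) show ?case
    by (induction y) (auto simp: power_mult_distrib right_diff_distrib intro: cyclotomic_span.intros)
qed (simp add: left_diff_distrib cyclotomic_span.diff)

lemma cyclotomic_span_power [intro]: "x \<in> cyclotomic_span n \<Longrightarrow> x ^ k \<in> cyclotomic_span n"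
  by (induction k) auto

lemma cyclotomic_span_sum [intro]:
  "(\<And>i. i \<in> I \<Longrightarrow> f i \<in> cyclotomic_span n) \<Longrightarrow> sum f I \<in> cyclotomic_span n"
  by (induction I rule: infinite_finite_induct) auto

lemma cyclotomic_span_of_int [simp, intro]: "of_int k \<in> cyclotomic_span n"
proof (induction k rule: int_induct[where k = 0])
  case (step1 i)
  then show ?case using cyclotomic_span_add[OF _ cyclotomic_span_one] by simp
next
  case (step2 i)
  then show ?case using cyclotomic_span.diff[OF _ cyclotomic_span_one] by simp
qed simp

text \<open>A Q-linear map extended from the independent set {1}. It carries an integrality question
  from the cyclotomic ring to the rationals, where denominators can be compared directly.\<close>

lemma rational_functional:
  "\<exists>f :: complex \<Rightarrow> rat. (\<forall>x y. f (x - y) = f x - f y) \<and> (\<forall>r x. f (of_rat r * x) = r * f x) \<and> f 1 = 1"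
proof -
  interpret vector_space_pair "\<lambda>r x. of_rat r * x :: complex" "(*) :: rat \<Rightarrow> rat \<Rightarrow> rat"
    by unfold_locales (auto simp: algebra_simps of_rat_add of_rat_mult)
  have "vs1.independent {1}" by (simp add: vs1.dependent_single)
  then obtain f where f: "Vector_Spaces.linear (\<lambda>r x. of_rat r * x :: complex) (*) f" "f 1 = 1"
    using linear_independent_extend[of "{1}" "\<lambda>_. 1"] by auto
  then show ?thesis
    by (intro exI[of _ f]) (auto simp: linear_diff linear_scale)
qed

text \<open>The span is generated as an additive group by finitely many roots of unity, so a common
  denominator of their images serves for all of it.\<close>

lemma cyclotomic_span_denominator:
  assumes n: "n > 0"
    and f: "\<And>x y. f (x - y) = f x - f y"
  shows "\<exists>D::int. D > 0 \<and> (\<forall>x\<in>cyclotomic_span n. of_int D * (f x :: rat) \<in> \<int>)"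
proof -
  have "\<exists>D::int. D > 0 \<and> (\<forall>x\<in>S. of_int D * f x \<in> \<int>)" if "finite S" for S
    using that
  proof induction
    case (insert z S)
    then obtain D :: int where D: "D > 0" "\<forall>x\<in>S. of_int D * f x \<in> \<int>" by blast
    obtain a b where ab: "quotient_of (f z) = (a, b)" by force
    then have b: "b > 0" "f z = of_int a / of_int b"
      by (auto simp: quotient_of_denom_pos quotient_of_div)
    have "of_int (D * b) * f z = of_int (D * a)" using b by simp
    then have "of_int (D * b) * f z \<in> \<int>" by (metis Ints_of_int)
    moreover have "of_int (D * b) * f x \<in> \<int>" if "x \<in> S" for x
    proof -
      have "of_int (D * b) * f x = of_int b * (of_int D * f x)" by simp
      then show ?thesis using D(2) that by (metis Ints_mult Ints_of_int)
    qed
    ultimately show ?case using D b by (intro exI[of _ "D * b"]) auto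
  qed (auto intro: exI[of _ 1])
  moreover have "finite {z :: complex. z ^ n = 1}" using n by (intro finite_roots_unity) simp
  ultimately obtain D :: int where D: "D > 0" "\<And>z. z ^ n = 1 \<Longrightarrow> of_int D * f z \<in> \<int>"
    by blast
  have "of_int D * f x \<in> \<int>" if "x \<in> cyclotomic_span n" for x
    using that by induction (auto simp: D f right_diff_distrib)
  then show ?thesis using D(1) by blast
qed

text \<open>An element of the span that is half an odd integer would have powers with unbounded
  denominators.\<close>

lemma half_odd_notin_cyclotomic_span:
  assumes n: "n > 0" and m: "odd (m :: int)"
  shows "of_int m / 2 \<notin> cyclotomic_span n"
proof
  assume h: "of_int m / 2 \<in> cyclotomic_span n"
  obtain f :: "complex \<Rightarrow> rat" where f: "\<And>x y. f (x - y) = f x - f y" "\<And>r x. f (of_rat r * x) = r * f x" "f 1 = 1"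
    using rational_functional by metis
  obtain D :: int where D: "D > 0" "\<And>x. x \<in> cyclotomic_span n \<Longrightarrow> of_int D * f x \<in> \<int>"
    using cyclotomic_span_denominator[OF n f(1)] by metis
  \<comment> \<open>The exponent has to satisfy 2^k > D; the value D itself will do, because k <
    2^k.\<close>
  define k where "k = nat D"
  have "(of_int m / 2 :: complex) ^ k = of_rat ((of_int m / 2) ^ k) * 1"
    by (simp add: of_rat_power of_rat_divide)
  then have "f ((of_int m / 2) ^ k) = (of_int m / 2) ^ k"
    using f(2)[of "(of_int m / 2) ^ k" 1] f(3) by simp
  then have "of_int D * (of_int m / 2 :: rat) ^ k \<in> \<int>"
    using D(2)[OF cyclotomic_span_power[OF h, of k]] by simp
  then obtain l :: int where "of_int D * (of_int m / 2 :: rat) ^ k = of_int l"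
    by (metis Ints_cases)
  then have "(of_int (D * m ^ k) :: rat) = of_int (l * 2 ^ k)"
    by (simp add: power_divide divide_eq_eq)
  then have "D * m ^ k = l * 2 ^ k" by (simp only: of_int_eq_iff)
  then have "2 ^ k dvd D * m ^ k" by simp
  moreover have "coprime (2 ^ k) (m ^ k)" using m by simp
  ultimately have "2 ^ k dvd D" by (simp add: coprime_dvd_mult_left_iff)
  then have "2 ^ k \<le> D" using D(1) by (rule zdvd_imp_le)
  moreover have "int k < 2 ^ k" by (metis of_nat_less_two_power)
  ultimately show False using D(1) by (simp add: k_def)
qed

text \<open>The localization of the span away from the odd integers, and in it the radical of the ideal
  generated by 2. Exponents that are powers of 2 suffice and make \<open>even_ideal\<close> visibly closed under
  addition, by the binomial congruence \<open>(x + y) ^ 2 ^ k \<equiv> x ^ 2 ^ k + y ^ 2 ^ k\<close> modulo 2.\<close>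

definition odd_local :: "nat \<Rightarrow> complex set" where
  "odd_local n = {x. \<exists>m::int. odd m \<and> of_int m * x \<in> cyclotomic_span n}"

definition even_ideal :: "nat \<Rightarrow> complex set" where
  "even_ideal n = {x \<in> odd_local n. \<exists>k. x ^ (2 ^ k) / 2 \<in> odd_local n}"

lemma cyclotomic_span_subset_odd_local: "x \<in> cyclotomic_span n \<Longrightarrow> x \<in> odd_local n"
  unfolding odd_local_def by (auto intro!: exI[of _ 1])

lemma odd_local_one [simp]: "1 \<in> odd_local n"
  and odd_local_zero [simp]: "0 \<in> odd_local n"
  and odd_local_of_int [simp]: "of_int k \<in> odd_local n"
  by (simp_all add: cyclotomic_span_subset_odd_local)

lemma odd_local_mult [intro]:
  assumes "x \<in> odd_local n" "y \<in> odd_local n" shows "x * y \<in> odd_local n"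
proof -
  obtain k l :: int where kl: "odd k" "odd l"
    "of_int k * x \<in> cyclotomic_span n" "of_int l * y \<in> cyclotomic_span n"
    using assms by (auto simp: odd_local_def)
  have "of_int (k * l) * (x * y) = (of_int k * x) * (of_int l * y)" by simp
  then have "of_int (k * l) * (x * y) \<in> cyclotomic_span n" using kl by (metis cyclotomic_span_mult)
  then show ?thesis unfolding odd_local_def using kl by (intro CollectI exI[of _ "k * l"]) simp
qed

lemma odd_local_add [intro]:
  assumes "x \<in> odd_local n" "y \<in> odd_local n" shows "x + y \<in> odd_local n"
proof -
  obtain k l :: int where kl: "odd k" "odd l"
    "of_int k * x \<in> cyclotomic_span n" "of_int l * y \<in> cyclotomic_span n"
    using assms by (auto simp: odd_local_def)
  have "of_int (k * l) * (x + y) = of_int l * (of_int k * x) + of_int k * (of_int l * y)"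
    by (simp add: algebra_simps)
  then have "of_int (k * l) * (x + y) \<in> cyclotomic_span n"
    using kl by (metis cyclotomic_span_mult cyclotomic_span_add cyclotomic_span_of_int)
  then show ?thesis unfolding odd_local_def using kl by (intro CollectI exI[of _ "k * l"]) simp
qed

lemma odd_local_minus [intro]: "x \<in> odd_local n \<Longrightarrow> - x \<in> odd_local n"
  using odd_local_mult[OF odd_local_of_int[of "- 1" n], of x] by simp

lemma odd_local_power [intro]: "x \<in> odd_local n \<Longrightarrow> x ^ k \<in> odd_local n"
  by (induction k) auto

lemma half_notin_odd_local: "n > 0 \<Longrightarrow> 1 / 2 \<notin> odd_local n"
  using half_odd_notin_cyclotomic_span by (auto simp: odd_local_def)

lemma even_ideal_subset: "x \<in> even_ideal n \<Longrightarrow> x \<in> odd_local n"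
  by (simp add: even_ideal_def)

text \<open>All powers of 1 are 1, so properness of the radical comes down to 1/2 lying outside the
  ring. The contradiction in \<open>alternating_notin_cube_group\<close> is with this fact.\<close>

lemma one_notin_even_ideal: "n > 0 \<Longrightarrow> 1 \<notin> even_ideal n"
  using half_notin_odd_local by (simp add: even_ideal_def)

lemma even_idealI: "x \<in> odd_local n \<Longrightarrow> x ^ (2 ^ k) / 2 \<in> odd_local n \<Longrightarrow> x \<in> even_ideal n"
  unfolding even_ideal_def by blast

lemma two_mult_even_ideal: "x \<in> odd_local n \<Longrightarrow> 2 * x \<in> even_ideal n"
  using odd_local_mult[OF odd_local_of_int[of 2]] by (intro even_idealI[where k = 0]) auto

lemma even_ideal_mult [intro]:
  assumes "x \<in> odd_local n" "y \<in> even_ideal n" shows "x * y \<in> even_ideal n"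
proof -
  obtain k where k: "y \<in> odd_local n" "y ^ (2 ^ k) / 2 \<in> odd_local n"
    using assms by (auto simp: even_ideal_def)
  have "x ^ (2 ^ k) * (y ^ (2 ^ k) / 2) \<in> odd_local n" using assms k by blast
  then show ?thesis using assms k by (intro even_idealI[where k = k]) (auto simp: power_mult_distrib)
qed

lemma power_two_power_add:
  assumes "x \<in> odd_local n" "y \<in> odd_local n"
  shows "((x + y) ^ (2 ^ k) - x ^ (2 ^ k) - y ^ (2 ^ k)) / 2 \<in> odd_local n"
proof (induction k)
  case (Suc k)
  define p q where "p = x ^ (2 ^ k)" and "q = y ^ (2 ^ k)"
  define r where "r = ((x + y) ^ (2 ^ k) - p - q) / 2"
  have r: "r \<in> odd_local n" using Suc by (simp add: r_def p_def q_def)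
  have pq: "p \<in> odd_local n" "q \<in> odd_local n" using assms by (auto simp: p_def q_def)
  have "(x + y) ^ (2 ^ k) = p + q + 2 * r" by (simp add: r_def)
  then have "((x + y) ^ (2 ^ Suc k) - x ^ (2 ^ Suc k) - y ^ (2 ^ Suc k)) / 2
      = ((p + q + 2 * r)\<^sup>2 - p\<^sup>2 - q\<^sup>2) / 2"
    by (simp add: power_mult power_mult[of _ "2 ^ k" 2] mult.commute[of 2] p_def q_def)
  also have "\<dots> = p * q + of_int 2 * (p * r + q * r + r * r)"
    by (simp add: power2_eq_square field_simps)
  also have "\<dots> \<in> odd_local n"
    using r pq by (intro odd_local_add odd_local_mult odd_local_of_int)
  finally show ?case .
qed simp

text \<open>Brings the exponents of two elements to a common value when they are added.\<close>

lemma even_ideal_power_mono: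
  assumes "x \<in> odd_local n" "x ^ (2 ^ k) / 2 \<in> odd_local n" "k \<le> l"
  shows "x ^ (2 ^ l) / 2 \<in> odd_local n"
proof -
  have "2 ^ l = 2 ^ k + (2 ^ l - 2 ^ k :: nat)"
    using power_increasing[OF assms(3), of "2::nat"] by simp
  then have "x ^ (2 ^ l) / 2 = (x ^ (2 ^ k) / 2) * x ^ (2 ^ l - 2 ^ k)"
    by (metis power_add times_divide_eq_left)
  also have "\<dots> \<in> odd_local n" using assms by blast
  finally show ?thesis .
qed

lemma even_ideal_add [intro]:
  assumes "x \<in> even_ideal n" "y \<in> even_ideal n" shows "x + y \<in> even_ideal n"
proof -
  obtain k l where kl: "x \<in> odd_local n" "x ^ (2 ^ k) / 2 \<in> odd_local n"
    "y \<in> odd_local n" "y ^ (2 ^ l) / 2 \<in> odd_local n"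
    using assms by (auto simp: even_ideal_def)
  let ?m = "max k l"
  have "(x + y) ^ (2 ^ ?m) / 2 = ((x + y) ^ (2 ^ ?m) - x ^ (2 ^ ?m) - y ^ (2 ^ ?m)) / 2
      + x ^ (2 ^ ?m) / 2 + y ^ (2 ^ ?m) / 2"
    by (simp add: diff_divide_distrib)
  also have "\<dots> \<in> odd_local n"
    by (intro odd_local_add power_two_power_add even_ideal_power_mono[OF kl(1,2)]
      even_ideal_power_mono[OF kl(3,4)] kl(1,3) max.cobounded1 max.cobounded2)
  finally have "(x + y) ^ (2 ^ ?m) / 2 \<in> odd_local n" .
  moreover have "x + y \<in> odd_local n" using kl(1,3) by (rule odd_local_add)
  ultimately show ?thesis by (metis even_idealI)
qed

lemma even_ideal_zero [simp]: "0 \<in> even_ideal n"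
  using two_mult_even_ideal[of 0 n] by simp

lemma even_ideal_minus [intro]: "x \<in> even_ideal n \<Longrightarrow> - x \<in> even_ideal n"
  using even_ideal_mult[OF odd_local_of_int[of "- 1" n], of x] by simp

lemma even_ideal_diff [intro]: "x \<in> even_ideal n \<Longrightarrow> y \<in> even_ideal n \<Longrightarrow> x - y \<in> even_ideal n"
  using even_ideal_add[OF _ even_ideal_minus] by force

text \<open>The 2-part of the order of \<open>x\<close> is split off: if \<open>y = x ^ 2 ^ k\<close> has odd order \<open>r > 1\<close>, then
  \<open>1 - x\<close> divides \<open>1 - y\<close>, which divides \<open>r = (\<Sum>j<r. 1 - y ^ j)\<close>; otherwise \<open>x\<close> has order
  \<open>2 ^ k\<close> with \<open>k \<ge> 2\<close>, and \<open>2 = 1 - x ^ 2 ^ (k - 1)\<close> is divisible by \<open>(1 - x) * (1 + x)\<close>.\<close>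

lemma two_div_one_minus_root:
  assumes n: "n > 0" and x: "x ^ n = 1" "x \<noteq> 1" "x \<noteq> - 1"
  shows "2 / (1 - x) \<in> even_ideal n"
proof -
  have xs: "x \<in> cyclotomic_span n" using x by (simp add: cyclotomic_span.root)
  obtain r where r: "n = 2 ^ multiplicity 2 n * r" "odd r"
    using multiplicity_decompose'[of n 2] n by auto
  define k where "k = multiplicity 2 n"
  have kr: "odd r" "n = 2 ^ k * r" using r by (simp_all add: k_def)
  define y where "y = x ^ (2 ^ k)"
  have yr: "y ^ r = 1" using x kr by (simp add: y_def flip: power_mult)
  have dvd1: "(1 - y) = (1 - x) * (\<Sum>j<2 ^ k. x ^ j)"
    by (simp add: y_def one_diff_power_eq)
  show ?thesis
  proof (cases "y = 1")
    case False
    have "(\<Sum>j<r. y ^ j) = 0"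
      using False yr one_diff_power_eq[of y r] by simp
    then have "of_nat r = (\<Sum>j<r. 1 - y ^ j)" by (simp add: sum_subtractf)
    also have "\<dots> = (1 - y) * (\<Sum>j<r. \<Sum>i<j. y ^ i)"
      by (simp add: one_diff_power_eq sum_distrib_left)
    finally have r: "of_nat r = (1 - x) * ((\<Sum>j<2 ^ k. x ^ j) * (\<Sum>j<r. \<Sum>i<j. y ^ i))"
      by (simp add: dvd1 mult.assoc)
    then have "of_int (int r) * (1 / (1 - x)) = (\<Sum>j<2 ^ k. x ^ j) * (\<Sum>j<r. \<Sum>i<j. y ^ i)"
      using x by (simp add: field_simps)
    also have "\<dots> \<in> cyclotomic_span n" unfolding y_def using xs
      by (intro cyclotomic_span_mult cyclotomic_span_sum cyclotomic_span_power)
    finally have "1 / (1 - x) \<in> odd_local n"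
      using kr unfolding odd_local_def by (intro CollectI exI[of _ "int r"]) simp
    then show ?thesis using two_mult_even_ideal[of "1 / (1 - x)"] by simp
  next
    case True
    define l where "l = (LEAST l. x ^ (2 ^ l) = 1)"
    have l: "x ^ (2 ^ l) = 1" 
      using LeastI[of "\<lambda>l. x ^ (2 ^ l) = 1" k] True by (simp add: y_def l_def)
    have "l \<noteq> 0" using l x by (cases l) auto
    moreover have "l \<noteq> 1" using l x by (auto simp: power2_eq_1_iff)
    ultimately obtain m where m: "l = Suc (Suc m)" by (metis One_nat_def not0_implies_Suc)
    have "x ^ (2 ^ Suc m) \<noteq> 1"
      using not_less_Least[of "Suc m" "\<lambda>l. x ^ (2 ^ l) = 1"] by (simp add: m flip: l_def)
    moreover have "(x ^ (2 ^ Suc m))\<^sup>2 = 1"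
      using l by (simp add: m mult.commute flip: power_mult)
    ultimately have "x ^ (2 ^ Suc m) = - 1" by (simp add: power2_eq_1_iff)
    then have "2 = 1 - (x\<^sup>2) ^ (2 ^ m)" by (simp flip: power_mult)
    also have "\<dots> = (1 - x\<^sup>2) * (\<Sum>j<2 ^ m. (x\<^sup>2) ^ j)"
      by (rule one_diff_power_eq)
    also have "1 - x\<^sup>2 = (1 - x) * (1 + x)"
      by (simp add: power2_eq_square algebra_simps)
    finally have eq: "2 / (1 - x) = (\<Sum>j<2 ^ m. (x\<^sup>2) ^ j) * (1 + x)"
      using x by (simp add: divide_eq_eq mult_ac)
    \<comment> \<open>Modulo 2 the power is 1 + x^(2^l) = 2, and half of this 2 is the last
      summand.\<close>
    have "(1 + x) ^ (2 ^ l) / 2 = ((1 + x) ^ (2 ^ l) - 1 ^ (2 ^ l) - x ^ (2 ^ l)) / 2 + 1"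
      using l by (simp add: diff_divide_distrib)
    also have "\<dots> \<in> odd_local n"
      using xs by (intro odd_local_add power_two_power_add cyclotomic_span_subset_odd_local) auto
    finally have "1 + x \<in> even_ideal n"
      using xs by (intro even_idealI[where k = l]) (auto intro: cyclotomic_span_subset_odd_local)
    then show ?thesis
      unfolding eq using xs by (intro even_ideal_mult cyclotomic_span_subset_odd_local) auto
  qed
qed

section \<open>Cube and dihedral rotations\<close>

lemmas matrix3_simps = matrix3_eq_iff matrix_matrix_mult_def transpose_def mat_def sum_3

lemma transpose_rotation:
  assumes "(A :: real^3^3) ** transpose A = mat 1"
  shows "transpose A ** A = mat 1"
  using assms by (simp add: matrix_left_right_inverse)

lemma inv_SO3:
  assumes "A \<in> carrier (SO3 \<real>)" shows "inv\<^bsub>SO3 \<real>\<^esub> A = transpose A"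
proof -
  interpret group "SO3 \<real>" by (rule group_SO3_real)
  have A: "det A = 1" "A ** transpose A = mat 1" using assms by (simp_all add: carrier_SO3_real)
  then have "transpose A \<in> carrier (SO3 \<real>)"
    by (simp add: carrier_SO3_real transpose_rotation)
  then show ?thesis
    using assms A by (intro inv_equality) (simp_all add: transpose_rotation)
qed

lemma subgroup_SO3_cancel:
  assumes H: "subgroup H (SO3 \<real>)" and B: "B \<in> H" and AB: "A ** B \<in> H"
  shows "A \<in> H"
proof -
  have "B \<in> carrier (SO3 \<real>)" using subgroup.mem_carrier[OF H B] .
  then have "transpose B \<in> H" "B ** transpose B = mat 1"
    using subgroup.m_inv_closed[OF H B] by (simp_all add: inv_SO3 carrier_SO3_real)
  moreover from this have "(A ** B) ** transpose B = A" by (simp flip: matrix_mul_assoc)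
  ultimately show ?thesis using subgroup.m_closed[OF H AB, of "transpose B"] by simp
qed

lemma subgroup_SO3_mult:
  assumes "subgroup H (SO3 \<real>)" "A \<in> H" "B \<in> H" shows "A ** B \<in> H"
  using subgroup.m_closed[OF assms] by simp

lemma carrier_cube_group:
  "carrier cube_group = {A \<in> carrier (SO3 \<real>). (\<lambda>v. A *v v) ` cube_vertices = cube_vertices}"
  by (simp add: cube_group_def rotation_subgroup_def)

lemma subgroup_cube_group: "subgroup (carrier cube_group) (SO3 \<real>)"
proof -
  interpret group "SO3 \<real>" by (rule group_SO3_real)
  show ?thesis
  proof (rule subgroupI)
    have "mat 1 \<in> carrier cube_group" using one_closed by (simp add: carrier_cube_group)
    then show "carrier cube_group \<noteq> {}" by blast
  next
    fix A B assume "A \<in> carrier cube_group" "B \<in> carrier cube_group"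
    then have AB: "A \<in> carrier (SO3 \<real>)" "B \<in> carrier (SO3 \<real>)"
      "(\<lambda>v. A *v v) ` cube_vertices = cube_vertices" "(\<lambda>v. B *v v) ` cube_vertices = cube_vertices"
      by (simp_all add: carrier_cube_group)
    have "(\<lambda>v. (A ** B) *v v) ` cube_vertices = (\<lambda>v. A *v v) ` (\<lambda>v. B *v v) ` cube_vertices"
      by (simp add: image_image matrix_vector_mul_assoc)
    then show "A \<otimes>\<^bsub>SO3 \<real>\<^esub> B \<in> carrier cube_group"
      using AB m_closed[OF AB(1,2)] by (simp add: carrier_cube_group)
  next
    fix A assume "A \<in> carrier cube_group"
    then have A: "A \<in> carrier (SO3 \<real>)" "(\<lambda>v. A *v v) ` cube_vertices = cube_vertices"
      by (simp_all add: carrier_cube_group)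
    then have t: "transpose A ** A = mat 1" by (simp add: carrier_SO3_real transpose_rotation)
    have "(\<lambda>v. transpose A *v v) ` cube_vertices
        = (\<lambda>v. transpose A *v v) ` (\<lambda>v. A *v v) ` cube_vertices" using A by simp
    also have "\<dots> = cube_vertices" using t by (simp add: image_image matrix_vector_mul_assoc del: transpose_matrix_vector)
    finally show "inv\<^bsub>SO3 \<real>\<^esub> A \<in> carrier cube_group"
      using A inv_closed[OF A(1)] by (simp add: carrier_cube_group inv_SO3)
  qed (simp add: carrier_cube_group)
qed

lemma sign_combination:
  fixes a b c x y z :: real
  assumes "a \<in> {- 1, 0, 1}" "b \<in> {- 1, 0, 1}" "c \<in> {- 1, 0, 1}" "a * a + b * b + c * c = 1"
    "x \<in> {1, - 1}" "y \<in> {1, - 1}" "z \<in> {1, - 1}"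
  shows "a * x + b * y + c * z = 1 \<or> a * x + b * y + c * z = - 1"
proof -
  have "\<bar>a\<bar> = 1 \<and> b = 0 \<and> c = 0 \<or> a = 0 \<and> \<bar>b\<bar> = 1 \<and> c = 0 \<or> a = 0 \<and> b = 0 \<and> \<bar>c\<bar> = 1"
    using assms(1-4) by auto
  moreover have "\<bar>x\<bar> = 1" "\<bar>y\<bar> = 1" "\<bar>z\<bar> = 1" using assms(5-7) by auto
  ultimately have "\<bar>a * x + b * y + c * z\<bar> = 1" by (auto simp: abs_mult)
  then show ?thesis by linarith
qed

lemma signed_maps_cube_vertices:
  assumes "A ** transpose A = mat 1" "\<And>i j. A $ i $ j \<in> {- 1, 0, 1}" "v \<in> cube_vertices"
  shows "A *v v \<in> cube_vertices"
proof -
  have v: "v $ i \<in> {1, - 1}" for i using assms(3) by (auto simp: cube_vertices_def)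
  have "(A ** transpose A) $ i $ i = 1" for i using assms(1) by (simp add: mat_def)
  then have "A $ i $ 1 * A $ i $ 1 + A $ i $ 2 * A $ i $ 2 + A $ i $ 3 * A $ i $ 3 = 1" for i
    by (simp add: matrix_matrix_mult_def transpose_def sum_3)
  then show ?thesis
    using sign_combination[OF assms(2) assms(2) assms(2) _ v v v]
    by (simp add: cube_vertices_def matrix_vector_mult_def sum_3)
qed

text \<open>Two vertices that differ only in coordinate \<open>j\<close> have images with entries 1
  or -1, and the difference of these images is twice column \<open>j\<close>. Conversely, a row of
  length 1 with entries in {-1, 0, 1} has a single nonzero entry, so it maps sign vectors to
  signs.\<close>

lemma cube_group_iff:
  "A \<in> carrier cube_group \<longleftrightarrow> A \<in> carrier (SO3 \<real>) \<and> (\<forall>i j. A $ i $ j \<in> {- 1, 0, 1})"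
proof (intro iffI conjI allI)
  fix i j assume "A \<in> carrier cube_group"
  then have A: "(\<lambda>v. A *v v) ` cube_vertices = cube_vertices" by (simp add: carrier_cube_group)
  define v w :: "real^3" where "v = (\<chi> k. 1)" and "w = (\<chi> k. if k = j then - 1 else 1)"
  have "v \<in> cube_vertices" "w \<in> cube_vertices" by (simp_all add: cube_vertices_def v_def w_def)
  then have "A *v v \<in> cube_vertices" "A *v w \<in> cube_vertices" using A by blast+
  then have vw: "(A *v v) $ i = 1 \<or> (A *v v) $ i = - 1" "(A *v w) $ i = 1 \<or> (A *v w) $ i = - 1"
    by (auto simp: cube_vertices_def)
  have "(A *v v) $ i - (A *v w) $ i = 2 * A $ i $ j"
    using exhaust_3[of j] by (auto simp: matrix_vector_mult_def v_def w_def sum_3)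
  then show "A $ i $ j \<in> {- 1, 0, 1}" using vw by auto
next
  assume A: "A \<in> carrier (SO3 \<real>) \<and> (\<forall>i j. A $ i $ j \<in> {- 1, 0, 1})"
  then have o: "A ** transpose A = mat 1" "transpose A ** A = mat 1"
    by (simp_all add: carrier_SO3_real transpose_rotation)
  have "(\<lambda>v. A *v v) ` cube_vertices = cube_vertices"
  proof (intro equalityI subsetI)
    fix v assume "v \<in> (\<lambda>v. A *v v) ` cube_vertices"
    then show "v \<in> cube_vertices" using A o signed_maps_cube_vertices[of A] by auto
  next
    fix v assume "v \<in> cube_vertices"
    then have "transpose A *v v \<in> cube_vertices"
      using A o signed_maps_cube_vertices[of "transpose A"] by (simp add: transpose_def)
    moreover have "A *v (transpose A *v v) = v" using o by (simp add: matrix_vector_mul_assoc del: transpose_matrix_vector)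
    ultimately show "v \<in> (\<lambda>v. A *v v) ` cube_vertices" by (metis image_eqI)
  qed
  then show "A \<in> carrier cube_group" using A by (simp add: carrier_cube_group)
qed (simp add: carrier_cube_group)

lemma rot_y_SO3: "rot_y t \<in> carrier (SO3 \<real>)"
  and rot_z_SO3: "rot_z t \<in> carrier (SO3 \<real>)"
  and rot_x_SO3: "rot_x t \<in> carrier (SO3 \<real>)"
  using sin_cos_squared_add[of t]
  by (simp_all add: carrier_SO3_real matrix3_simps det_3 rot_y_def rot_z_def rot_x_def power2_eq_square)

lemma rot_y_cube: "rot_y (pi / 2) \<in> carrier cube_group"
  and rot_z_cube: "rot_z (pi / 2) \<in> carrier cube_group"
  using rot_y_SO3[of "pi / 2"] rot_z_SO3[of "pi / 2"]
  by (simp_all add: cube_group_iff forall_3 rot_y_def rot_z_def)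

lemma rot_x_cube: "rot_x pi \<in> carrier cube_group"
  using rot_x_SO3[of pi] by (simp add: cube_group_iff forall_3 rot_x_def)

lemma rotation_fixing_z:
  assumes A: "A \<in> carrier (SO3 \<real>)" and 33: "A $ 3 $ 3 = 1"
  shows "A $ 3 $ 1 = 0 \<and> A $ 3 $ 2 = 0 \<and> A $ 1 $ 3 = 0 \<and> A $ 2 $ 3 = 0
    \<and> A $ 2 $ 2 = A $ 1 $ 1 \<and> A $ 1 $ 2 = - A $ 2 $ 1 \<and> (A $ 1 $ 1)\<^sup>2 + (A $ 2 $ 1)\<^sup>2 = 1"
proof -
  have o: "A ** transpose A = mat 1" "transpose A ** A = mat 1" "det A = 1"
    using A by (simp_all add: carrier_SO3_real transpose_rotation)
  have "(A $ 3 $ 1)\<^sup>2 + (A $ 3 $ 2)\<^sup>2 = 0" "(A $ 1 $ 3)\<^sup>2 + (A $ 2 $ 3)\<^sup>2 = 0"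
    using o(1,2) 33 by (simp_all add: matrix3_simps power2_eq_square)
  then have z: "A $ 3 $ 1 = 0" "A $ 3 $ 2 = 0" "A $ 1 $ 3 = 0" "A $ 2 $ 3 = 0"
    by (simp_all add: sum_power2_eq_zero_iff)
  define a b c d where "a = A $ 1 $ 1" and "b = A $ 1 $ 2" and "c = A $ 2 $ 1" and "d = A $ 2 $ 2"
  have e: "a * a + c * c = 1" "a * d - b * c = 1" "a * b + c * d = 0"
    using o(2,3) 33 z by (simp_all add: matrix3_simps det_3 a_def b_def c_def d_def)
  \<comment> \<open>The last two equations of \<open>e\<close> are linear in \<open>b\<close> and
    \<open>d\<close>; these combinations solve them, as the factor \<open>a * a + c * c\<close> is
    1.\<close>
  have "(a * a + c * c) * d = a * (a * d - b * c) + c * (a * b + c * d)"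
    "(a * a + c * c) * b = a * (a * b + c * d) - c * (a * d - b * c)"
    by (simp_all add: algebra_simps)
  then have "d = a" "b = - c" using e by simp_all
  then show ?thesis using z e(1) by (simp add: a_def b_def c_def d_def power2_eq_square)
qed

lemma rot_z_add: "rot_z a ** rot_z b = rot_z (a + b)"
  by (simp add: matrix3_simps rot_z_def cos_add sin_add algebra_simps)

lemma rot_z_zero: "rot_z 0 = mat 1"
  by (simp add: matrix3_simps rot_z_def)

lemma rot_z_multiple_mem:
  assumes "subgroup H (SO3 \<real>)" "rot_z t \<in> H"
  shows "rot_z (real k * t) \<in> H"
proof (induction k)
  case 0
  then show ?case using subgroup.one_closed[OF assms(1)] by (simp add: rot_z_zero)
next
  case (Suc k)
  then show ?case
    using subgroup_SO3_mult[OF assms(1) assms(2) Suc] by (simp add: rot_z_add algebra_simps)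
qed

text \<open>Such a rotation is one of the four multiples of the quarter turn about the z-axis. The
  subgroup is left arbitrary so that the lemma serves both for generating the cube group and for the
  dihedral group.\<close>

lemma cube_fixing_z_mem:
  assumes H: "subgroup H (SO3 \<real>)" and Z: "rot_z (pi / 2) \<in> H"
    and A: "A \<in> carrier cube_group" "A $ 3 $ 3 = 1"
  shows "A \<in> H"
proof -
  have s: "A $ i $ j \<in> {- 1, 0, 1}" for i j using A by (simp add: cube_group_iff)
  have f: "A $ 3 $ 1 = 0" "A $ 3 $ 2 = 0" "A $ 1 $ 3 = 0" "A $ 2 $ 3 = 0"
    "A $ 2 $ 2 = A $ 1 $ 1" "A $ 1 $ 2 = - A $ 2 $ 1" "(A $ 1 $ 1)\<^sup>2 + (A $ 2 $ 1)\<^sup>2 = 1"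
    using rotation_fixing_z[of A] A by (simp_all add: cube_group_iff)
  have angle: "A = rot_z t" if "cos t = A $ 1 $ 1" "sin t = A $ 2 $ 1" for t
    using f A(2) that by (simp add: matrix3_eq_iff rot_z_def)
  have cs: "cos (real 3 * (pi / 2)) = 0" "sin (real 3 * (pi / 2)) = - 1"
    using cos_3over2_pi sin_3over2_pi by (simp_all add: mult.commute)
  have "A $ 1 $ 1 = 1 \<and> A $ 2 $ 1 = 0 \<or> A $ 1 $ 1 = 0 \<and> A $ 2 $ 1 = 1
      \<or> A $ 1 $ 1 = - 1 \<and> A $ 2 $ 1 = 0 \<or> A $ 1 $ 1 = 0 \<and> A $ 2 $ 1 = - 1"
    using s[of 1 1] s[of 2 1] f(7) by auto
  then have "A = rot_z (real 0 * (pi / 2)) \<or> A = rot_z (real 1 * (pi / 2)) \<or> A = rot_z (real 2 * (pi / 2))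
      \<or> A = rot_z (real 3 * (pi / 2))"
    using angle[of "real 0 * (pi / 2)"] angle[of "real 1 * (pi / 2)"] angle[of "real 2 * (pi / 2)"]
      angle[of "real 3 * (pi / 2)"] cs by auto
  then show ?thesis using rot_z_multiple_mem[OF H Z] by metis
qed

text \<open>The third row has exactly one nonzero entry. Right multiplication by quarter turns moves
  it to the corner and makes it 1, which leaves a rotation about the z-axis; the turns are then
  cancelled inside \<open>H\<close>.\<close>

lemma cube_group_generated:
  assumes H: "subgroup H (SO3 \<real>)" and R: "rot_y (pi / 2) \<in> H" and Z: "rot_z (pi / 2) \<in> H"
    and A: "A \<in> carrier cube_group"
  shows "A \<in> H"
proof -
  let ?R = "rot_y (pi / 2)" and ?Z = "rot_z (pi / 2)"
  note cube_mult = subgroup_SO3_mult[OF subgroup_cube_group]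
  have 1: "A \<in> H" if "A \<in> carrier cube_group" "A $ 3 $ 3 \<in> {1, - 1}" for A
  proof (cases "A $ 3 $ 3 = 1")
    case True
    then show ?thesis using cube_fixing_z_mem[OF H Z that(1)] by blast
  next
    case False
    have "(A ** (?R ** ?R)) $ 3 $ 3 = 1"
      using False that(2) by (simp add: matrix_matrix_mult_def sum_3 rot_y_def)
    moreover have "A ** (?R ** ?R) \<in> carrier cube_group"
      using that(1) by (intro cube_mult rot_y_cube)
    ultimately have "A ** (?R ** ?R) \<in> H" using cube_fixing_z_mem[OF H Z] by blast
    then show ?thesis using subgroup_SO3_cancel[OF H] subgroup_SO3_mult[OF H R R] by blast
  qed
  have 2: "A \<in> H" if "A \<in> carrier cube_group" "A $ 3 $ 1 \<in> {1, - 1}" for A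
  proof -
    have "(A ** ?R) $ 3 $ 3 = A $ 3 $ 1" by (simp add: matrix_matrix_mult_def sum_3 rot_y_def)
    then have "A ** ?R \<in> H" using that by (intro 1 cube_mult rot_y_cube) auto
    then show ?thesis using subgroup_SO3_cancel[OF H R] by blast
  qed
  have 3: "A \<in> H" if "A \<in> carrier cube_group" "A $ 3 $ 2 \<in> {1, - 1}" for A
  proof -
    have "(A ** ?Z) $ 3 $ 1 = A $ 3 $ 2" by (simp add: matrix_matrix_mult_def sum_3 rot_z_def)
    then have "A ** ?Z \<in> H" using that by (intro 2 cube_mult rot_z_cube) auto
    then show ?thesis using subgroup_SO3_cancel[OF H Z] by blast
  qed
  have "A ** transpose A = mat 1" using A by (simp add: cube_group_iff carrier_SO3_real)
  then have "A $ 3 $ 1 * A $ 3 $ 1 + A $ 3 $ 2 * A $ 3 $ 2 + A $ 3 $ 3 * A $ 3 $ 3 = 1"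
    by (simp add: matrix3_simps)
  moreover have "A $ 3 $ 1 \<in> {- 1, 0, 1}" "A $ 3 $ 2 \<in> {- 1, 0, 1}" "A $ 3 $ 3 \<in> {- 1, 0, 1}"
    using A by (simp_all add: cube_group_iff)
  ultimately have "A $ 3 $ 1 \<in> {1, - 1} \<or> A $ 3 $ 2 \<in> {1, - 1} \<or> A $ 3 $ 3 \<in> {1, - 1}"
    by auto
  then show ?thesis using 1[OF A] 2[OF A] 3[OF A] by blast
qed

text \<open>The rotation \<open>rot_z t\<close>, followed on the right by \<open>rot_x pi\<close>
  when \<open>e = - 1\<close>. One formula for rotations and half turns makes the product law
  uniform.\<close>

definition dihedral_mat :: "real \<Rightarrow> real \<Rightarrow> real^3^3" where
  "dihedral_mat t e = vector [vector [cos t, - e * sin t, 0],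
                              vector [sin t, e * cos t, 0],
                              vector [0, 0, e]]"

lemma dihedral_mat_mult:
  "e \<in> {1, - 1} \<Longrightarrow> dihedral_mat t e ** dihedral_mat u f = dihedral_mat (t + e * u) (e * f)"
  by (auto simp: matrix3_simps dihedral_mat_def cos_add sin_add cos_diff sin_diff algebra_simps)

lemma subgroup_dihedral_rot: "subgroup (carrier (dihedral_rot m)) (SO3 \<real>)"
proof -
  interpret group "SO3 \<real>" by (rule group_SO3_real)
  show ?thesis
    unfolding dihedral_rot_def rotation_subgroup_def
    using generate_is_subgroup[of "{rot_z (2 * pi / real m), rot_x pi}"]
    by (simp add: rot_z_SO3 rot_x_SO3)
qed

lemma rot_z_dihedral_rot: "rot_z (2 * pi / real m) \<in> carrier (dihedral_rot m)"
  and rot_x_dihedral_rot: "rot_x pi \<in> carrier (dihedral_rot m)"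
  by (auto simp: dihedral_rot_def rotation_subgroup_def intro: generate.incl)

lemma dihedral_rot_cases:
  assumes "d \<in> carrier (dihedral_rot m)"
  obtains j :: int and e where "e \<in> {1, - 1}" "d = dihedral_mat (real_of_int j * (2 * pi / real m)) e"
proof -
  let ?t = "2 * pi / real m"
  have z: "rot_z t = dihedral_mat t 1" for t by (simp add: matrix3_eq_iff rot_z_def dihedral_mat_def)
  have x: "rot_x pi = dihedral_mat 0 (- 1)" by (simp add: matrix3_eq_iff rot_x_def dihedral_mat_def)
  have d: "d \<in> generate (SO3 \<real>) {rot_z ?t, rot_x pi}"
    using assms by (simp add: dihedral_rot_def rotation_subgroup_def)
  define P where "P h \<longleftrightarrow> (\<exists>(j::int) e. e \<in> {1, - 1} \<and> h = dihedral_mat (real_of_int j * ?t) e)" for h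
  have P: "P (dihedral_mat (real_of_int j * ?t) e)" if "e \<in> {1, - 1}" for j e
    unfolding P_def using that by blast
  from d have "P d"
  proof induction
    case one
    have "mat 1 = dihedral_mat (real_of_int 0 * ?t) 1" by (simp add: matrix3_simps dihedral_mat_def)
    then show ?case using P[of 1 0] by simp
  next
    case (incl h)
    then show ?case using P[of 1 1] P[of "- 1" 0] by (auto simp: z x)
  next
    case (inv h)
    then have "inv\<^bsub>SO3 \<real>\<^esub> h = transpose h" by (auto simp: inv_SO3 rot_z_SO3 rot_x_SO3)
    moreover have "transpose (rot_z ?t) = dihedral_mat (real_of_int (- 1) * ?t) 1"
      "transpose (rot_x pi) = dihedral_mat (real_of_int 0 * ?t) (- 1)"
      by (simp_all add: matrix3_eq_iff transpose_def rot_z_def rot_x_def dihedral_mat_def)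
    ultimately show ?case using inv P[of 1 "- 1"] P[of "- 1" 0] by auto
  next
    case (eng h1 h2)
    then obtain j1 j2 :: int and e1 e2 where h: "e1 \<in> {1, - 1}" "h1 = dihedral_mat (real_of_int j1 * ?t) e1"
      "e2 \<in> {1, - 1}" "h2 = dihedral_mat (real_of_int j2 * ?t) e2" by (auto simp: P_def)
    \<comment> \<open>The sign is rewritten as an integer so that the angle of the product is
      visibly an integer multiple of \<open>?t\<close>.\<close>
    have k: "e1 = real_of_int (if e1 = 1 then 1 else - 1)" using h(1) by auto
    have "real_of_int j1 * ?t + e1 * (real_of_int j2 * ?t)
        = real_of_int (j1 + (if e1 = 1 then 1 else - 1) * j2) * ?t"
      by (subst k) (simp add: distrib_right add_divide_distrib diff_divide_distrib)
    then have "h1 ** h2 = dihedral_mat (real_of_int (j1 + (if e1 = 1 then 1 else - 1) * j2) * ?t) (e1 * e2)"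
      by (simp only: h(2,4) dihedral_mat_mult[OF h(1)])
    moreover have "e1 * e2 \<in> {1, - 1}" using h(1,3) by auto
    ultimately show ?case using P by (metis SO3_simps(1))
  qed
  then show ?thesis using that by (auto simp: P_def)
qed

text \<open>Applied in contrapositive form: a cube rotation outside D_n has corner entry 0, which is
  the input of \<open>cube_step\<close>.\<close>

lemma cube_fixing_z_axis_dihedral:
  assumes m: "m > 0" "4 dvd m" and A: "A \<in> carrier cube_group" "A $ 3 $ 3 \<noteq> 0"
  shows "A \<in> carrier (dihedral_rot m)"
proof -
  note H = subgroup_dihedral_rot[of m]
  obtain k where k: "m = 4 * k" using m by blast
  have "rot_z (real k * (2 * pi / real m)) \<in> carrier (dihedral_rot m)"
    by (rule rot_z_multiple_mem[OF H rot_z_dihedral_rot])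
  then have Z: "rot_z (pi / 2) \<in> carrier (dihedral_rot m)" using m by (simp add: k field_simps)
  show ?thesis
  proof (cases "A $ 3 $ 3 = 1")
    case True
    then show ?thesis using cube_fixing_z_mem[OF H Z A(1)] by blast
  next
    case False
    moreover have "A $ 3 $ 3 \<in> {- 1, 0, 1}" using A(1) by (simp add: cube_group_iff)
    ultimately have "(A ** rot_x pi) $ 3 $ 3 = 1"
      using A(2) by (simp add: matrix_matrix_mult_def sum_3 rot_x_def)
    moreover have "A ** rot_x pi \<in> carrier cube_group"
      using A(1) rot_x_cube subgroup_SO3_mult[OF subgroup_cube_group] by blast
    ultimately have "A ** rot_x pi \<in> carrier (dihedral_rot m)"
      using cube_fixing_z_mem[OF H Z] by blast
    then show ?thesis using subgroup_SO3_cancel[OF H rot_x_dihedral_rot] by blast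
  qed
qed

section \<open>Rotations modulo 2\<close>

text \<open>With z = \<open>cis t\<close>, 1 / cos t = z * 2 / (1 + z^2) and tan t - 1 = \<i> * 2 /
  (1 + z^2) - (1 + \<i>). The assumption that z^4 is not 1 says that -z^2 is neither 1 nor -1, so
  \<open>two_div_one_minus_root\<close> applies to it. The remaining term 1 + \<i> lies in the
  radical of 2 because its square is 2 \<i>.\<close>

lemma root_even_cos_tan:
  assumes n: "n > 0" "4 dvd n" and z: "cis t ^ n = 1" "cis t ^ 4 \<noteq> 1"
  shows "cos t \<noteq> 0" and "of_real (1 / cos t) \<in> even_ideal n"
    and "of_real (tan t) - 1 \<in> even_ideal n"
proof -
  define z where "z = cis t"
  have zs: "z \<in> odd_local n"
    using z(1) by (simp add: z_def cyclotomic_span.root cyclotomic_span_subset_odd_local)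
  obtain k where k: "n = 4 * k" using n(2) by blast
  have i: "\<i> \<in> odd_local n"
    by (rule cyclotomic_span_subset_odd_local, rule cyclotomic_span.root) (simp add: k power_mult)
  have "(- z\<^sup>2) ^ n = (z ^ n)\<^sup>2"
    by (simp add: k power_mult_distrib flip: power_mult)
  then have "(- z\<^sup>2) ^ n = 1" using z(1) by (simp add: z_def)
  moreover have "z ^ 4 = (z\<^sup>2)\<^sup>2" by simp
  then have ne: "z\<^sup>2 \<noteq> 1" "z\<^sup>2 \<noteq> - 1" using z(2) unfolding z_def by (metis power2_minus power_one)+
  then have "- z\<^sup>2 \<noteq> 1" "- z\<^sup>2 \<noteq> - 1" by (metis minus_minus)+
  ultimately have w: "2 / (1 + z\<^sup>2) \<in> even_ideal n"
    using two_div_one_minus_root[OF n(1), of "- z\<^sup>2"] by simp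
  have z0: "z \<noteq> 0" by (simp add: z_def)
  have w0: "1 + z\<^sup>2 \<noteq> 0" using ne(2) by (metis add.inverse_unique)
  define z' where "z' = cis (- t)"
  have zz: "z * z' = 1" by (simp add: z_def z'_def cis_mult)
  have cs: "complex_of_real (cos t) = (z + z') / 2" "complex_of_real (sin t) = - \<i> * (z - z') / 2"
    by (simp_all add: z_def z'_def complex_eq_iff)
  have "complex_of_real (cos t) * (2 * z) = z\<^sup>2 + z * z'"
    "complex_of_real (sin t) * (2 * z) = - \<i> * (z\<^sup>2 - z * z')"
    unfolding cs by (simp_all add: power2_eq_square algebra_simps)
  then have cos: "complex_of_real (cos t) = (1 + z\<^sup>2) / (2 * z)"
    and sin: "complex_of_real (sin t) = - \<i> * (z\<^sup>2 - 1) / (2 * z)"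
    using z0 by (subst nonzero_eq_divide_eq, simp, simp add: zz add.commute)+
  show c0: "cos t \<noteq> 0" using cos w0 z0 by auto
  have "complex_of_real (1 / cos t) = z * (2 / (1 + z\<^sup>2))" by (simp add: cos)
  then show "of_real (1 / cos t) \<in> even_ideal n" using even_ideal_mult[OF zs w] by simp
  have "complex_of_real (tan t) - 1 = \<i> * (2 / (1 + z\<^sup>2)) + - (1 + \<i>)"
  proof -
    have "complex_of_real (tan t) = - \<i> * (z\<^sup>2 - 1) / (1 + z\<^sup>2)"
      using z0 by (simp add: tan_def cos sin)
    also have "\<dots> = \<i> * (2 / (1 + z\<^sup>2)) - \<i> * ((1 + z\<^sup>2) / (1 + z\<^sup>2))"
      by (simp only: times_divide_eq_right flip: diff_divide_distrib) (simp add: algebra_simps)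
    finally show ?thesis using w0 by simp
  qed
  moreover have "1 + \<i> \<in> even_ideal n"
  proof (rule even_idealI[where k = 1])
    have "(1 + \<i>) ^ 2 ^ 1 / 2 = \<i>" by (simp add: power2_eq_square algebra_simps)
    then show "(1 + \<i>) ^ 2 ^ 1 / 2 \<in> odd_local n" using i by simp
    show "1 + \<i> \<in> odd_local n" by (rule odd_local_add[OF odd_local_one i])
  qed
  then have "\<i> * (2 / (1 + z\<^sup>2)) + - (1 + \<i>) \<in> even_ideal n"
    by (intro even_ideal_add[OF even_ideal_mult[OF i w]] even_ideal_minus)
  ultimately show "of_real (tan t) - 1 \<in> even_ideal n" by (simp only:)
qed

text \<open>The congruence y = u for the vector u = (1,1,0), which points along the diagonal of the
  xy-plane.\<close>

definition near_diagonal :: "nat \<Rightarrow> real^3 \<Rightarrow> bool" where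
  "near_diagonal n y \<longleftrightarrow> of_real (y $ 1) - 1 \<in> even_ideal n \<and> of_real (y $ 2) - 1 \<in> even_ideal n
     \<and> of_real (y $ 3) \<in> even_ideal n"

lemma odd_localI_even_ideal: "x - 1 \<in> even_ideal n \<Longrightarrow> x \<in> odd_local n"
  using odd_local_add[OF even_ideal_subset odd_local_one] by force

text \<open>The second assumption on \<open>y\<close> is u^T y = 1 modulo the ideal, and the rank
  one matrix u u^T sends such a vector to u. The witness is the reciprocal of the cosine.\<close>

lemma dihedral_step:
  assumes n: "n > 0" "4 dvd n"
    and d: "d \<in> carrier (dihedral_rot n)" "d \<notin> carrier cube_group"
    and y: "\<And>i. of_real (y $ i) \<in> odd_local n" "of_real (y $ 1 + y $ 2) - 1 \<in> even_ideal n"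
  shows "\<exists>c. of_real c \<in> even_ideal n \<and> near_diagonal n (c *\<^sub>R (d *v y))"
proof -
  obtain j :: int and e where e: "e \<in> {1, - 1}"
    and d_eq: "d = dihedral_mat (real_of_int j * (2 * pi / real n)) e"
    using dihedral_rot_cases[OF d(1)] by metis
  define t where "t = real_of_int j * (2 * pi / real n)"
  have d_eq: "d = dihedral_mat t e" by (simp add: d_eq t_def)
  have "real n * t = 2 * pi * real_of_int j" using n by (simp add: t_def)
  then have tn: "cis t ^ n = 1"
    by (simp only: Complex.DeMoivre) (simp add: cis_multiple_2pi)
  \<comment> \<open>Otherwise t is a multiple of pi/2 and \<open>d\<close> is a signed permutation
    matrix, hence a cube rotation.\<close>
  have "cis t ^ 4 \<noteq> 1"
  proof
    assume "cis t ^ 4 = 1"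
    moreover have "(cis t ^ 2 - 1) * (cis t ^ 2 + 1) = cis t ^ 4 - 1"
      by (simp add: power2_eq_square power4_eq_xxxx algebra_simps del: cis_mult)
    ultimately have "cis t ^ 2 = 1 \<or> cis t ^ 2 = - 1" by (simp add: eq_neg_iff_add_eq_0)
    then have "cis t = 1 \<or> cis t = - 1 \<or> cis t = \<i> \<or> cis t = - \<i>"
      using power2_eq_iff[of "cis t" \<i>] power2_eq_iff[of "cis t" 1] by (simp del: cis.sel)
    then have "Re (cis t) \<in> {- 1, 0, 1} \<and> Im (cis t) \<in> {- 1, 0, 1}"
      by (elim disjE) (simp_all del: cis.sel)
    then have "cos t \<in> {- 1, 0, 1}" "sin t \<in> {- 1, 0, 1}" by simp_all
    then have "d $ i $ j \<in> {- 1, 0, 1}" for i j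
      using e exhaust_3[of i] exhaust_3[of j] by (auto simp: d_eq dihedral_mat_def)
    moreover have "d \<in> carrier (SO3 \<real>)" using subgroup.mem_carrier[OF subgroup_dihedral_rot d(1)] .
    ultimately show False using d(2) by (simp add: cube_group_iff)
  qed
  note ct = root_even_cos_tan[OF n tn this]
  have tan: "complex_of_real (tan t) \<in> odd_local n" using odd_localI_even_ideal[OF ct(3)] .
  have two: "2 * x \<in> even_ideal n" if "x \<in> odd_local n" for x using two_mult_even_ideal[OF that] .
  \<comment> \<open>Signs are invisible modulo 2, so the sum may be replaced by the difference and
    the factor \<open>e\<close> does no harm.\<close>
  have minus: "complex_of_real (y $ 1 - y $ 2) - 1 \<in> even_ideal n"
    using even_ideal_diff[OF y(2) two[OF y(1)[of 2]]] by (simp add: diff_diff_eq2 add_diff_eq)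
  have ey: "complex_of_real (y $ 1 + e * y $ 2) - 1 \<in> even_ideal n"
    "complex_of_real (y $ 1 - e * y $ 2) - 1 \<in> even_ideal n"
    using e y(2) minus by auto
  define c where "c = 1 / cos t"
  have cJ: "of_real c \<in> even_ideal n" using ct(2) by (simp only: c_def)
  have c: "c * cos t = 1" "c * sin t = tan t" using ct(1) by (simp_all add: c_def tan_def)
  have "(c *\<^sub>R (d *v y)) $ 1 = (c * cos t) * y $ 1 - e * (c * sin t) * y $ 2"
    "(c *\<^sub>R (d *v y)) $ 2 = (c * sin t) * y $ 1 + e * (c * cos t) * y $ 2"
    "(c *\<^sub>R (d *v y)) $ 3 = e * y $ 3 * c"
    by (simp_all add: d_eq dihedral_mat_def matrix_vector_mult_def sum_3 algebra_simps)
  then have comp: "(c *\<^sub>R (d *v y)) $ 1 = y $ 1 - e * tan t * y $ 2"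
    "(c *\<^sub>R (d *v y)) $ 2 = tan t * y $ 1 + e * y $ 2"
    "(c *\<^sub>R (d *v y)) $ 3 = e * y $ 3 * c"
    by (simp_all only: c mult_1_left mult_1_right)
  have eR: "complex_of_real e \<in> odd_local n" using e odd_local_minus[OF odd_local_one] by auto
  have 1: "of_real (y $ 1 - e * tan t * y $ 2) - 1 \<in> even_ideal n"
  proof -
    have "complex_of_real (y $ 1 - e * tan t * y $ 2) - 1
        = (of_real (y $ 1 - e * y $ 2) - 1) - (of_real e * of_real (y $ 2)) * (of_real (tan t) - 1)"
      by (simp add: algebra_simps)
    also have "\<dots> \<in> even_ideal n"
      by (intro even_ideal_diff[OF ey(2)] even_ideal_mult[OF odd_local_mult] eR y(1) ct(3))
    finally show ?thesis .
  qed
  have 2: "of_real (tan t * y $ 1 + e * y $ 2) - 1 \<in> even_ideal n"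
  proof -
    have "complex_of_real (tan t * y $ 1 + e * y $ 2) - 1
        = (of_real (y $ 1 + e * y $ 2) - 1) + of_real (y $ 1) * (of_real (tan t) - 1)"
      by (simp add: algebra_simps)
    also have "\<dots> \<in> even_ideal n"
      by (intro even_ideal_add[OF ey(1)] even_ideal_mult y(1) ct(3))
    finally show ?thesis .
  qed
  have 3: "of_real (e * y $ 3 * c) \<in> even_ideal n"
    using even_ideal_mult[OF odd_local_mult[OF eR y(1)[of 3]] ct(2)] by (simp add: c_def)
  show ?thesis
    using cJ 1 2 3 by (intro exI[of _ c]) (simp only: near_diagonal_def comp simp_thms)
qed

lemma sign_parity: "a \<in> {- 1, 0, 1} \<Longrightarrow> \<exists>k::int. a = a * a + 2 * real_of_int k"
  by (auto intro: exI[of _ "- 1"] exI[of _ 0])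

text \<open>For y = u the quantity y_1 + y_2 becomes u^T a u, the sum of the upper left block of
  \<open>a\<close>. The entries are 0, 1 or -1 and so agree with their squares modulo 2, and
  orthogonality determines the sum of the squares.\<close>

lemma cube_step:
  assumes a: "a \<in> carrier cube_group" "a $ 3 $ 3 = 0" and y: "near_diagonal n y"
  shows "\<And>i. of_real ((a *v y) $ i) \<in> odd_local n"
    and "of_real ((a *v y) $ 1 + (a *v y) $ 2) - 1 \<in> even_ideal n"
proof -
  have s: "a $ i $ j \<in> {- 1, 0, 1}" for i j using a(1) by (simp add: cube_group_iff)
  have aR: "complex_of_real (a $ i $ j) \<in> odd_local n" for i j
    using s[of i j] odd_local_minus[OF odd_local_one] by auto
  have yJ: "of_real (y $ 1) - 1 \<in> even_ideal n" "of_real (y $ 2) - 1 \<in> even_ideal n"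
    "of_real (y $ 3) \<in> even_ideal n" using y by (simp_all add: near_diagonal_def)
  have yR: "of_real (y $ i) \<in> odd_local n" for i
    using exhaust_3[of i] odd_localI_even_ideal[OF yJ(1)] odd_localI_even_ideal[OF yJ(2)]
      even_ideal_subset[OF yJ(3)] by auto
  show "of_real ((a *v y) $ i) \<in> odd_local n" for i
    by (simp add: matrix_vector_mult_def sum_3) (intro odd_local_add odd_local_mult aR yR)
  have o: "a ** transpose a = mat 1" "transpose a ** a = mat 1"
    using a(1) by (simp_all add: cube_group_iff carrier_SO3_real transpose_rotation)
  \<comment> \<open>The squares of all nine entries add up to 3. The third row and the third column
    contribute 1 each and meet only in the corner, which is 0.\<close>
  have norms: "a $ 1 $ 1 * a $ 1 $ 1 + a $ 1 $ 2 * a $ 1 $ 2 + a $ 2 $ 1 * a $ 2 $ 1 + a $ 2 $ 2 * a $ 2 $ 2 = 1"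
    using o a(2) by (simp add: matrix3_simps)
  obtain k1 k2 k3 k4 :: int where
    "a $ 1 $ 1 = a $ 1 $ 1 * a $ 1 $ 1 + 2 * real_of_int k1"
    "a $ 1 $ 2 = a $ 1 $ 2 * a $ 1 $ 2 + 2 * real_of_int k2"
    "a $ 2 $ 1 = a $ 2 $ 1 * a $ 2 $ 1 + 2 * real_of_int k3"
    "a $ 2 $ 2 = a $ 2 $ 2 * a $ 2 $ 2 + 2 * real_of_int k4"
    using sign_parity[OF s] by metis
  then have "a $ 1 $ 1 + a $ 1 $ 2 + a $ 2 $ 1 + a $ 2 $ 2 = 1 + 2 * real_of_int (k1 + k2 + k3 + k4)"
    using norms by simp
  then have S: "complex_of_real (a $ 1 $ 1 + a $ 1 $ 2 + a $ 2 $ 1 + a $ 2 $ 2)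
      = 1 + 2 * of_int (k1 + k2 + k3 + k4)"
    by (metis of_real_add of_real_mult of_real_1 of_real_numeral of_real_of_int_eq)
  have "complex_of_real ((a *v y) $ 1 + (a *v y) $ 2) - 1
      = (of_real (a $ 1 $ 1) + of_real (a $ 2 $ 1)) * (of_real (y $ 1) - 1)
        + (of_real (a $ 1 $ 2) + of_real (a $ 2 $ 2)) * (of_real (y $ 2) - 1)
        + (of_real (a $ 1 $ 3) + of_real (a $ 2 $ 3)) * of_real (y $ 3)
        + (complex_of_real (a $ 1 $ 1 + a $ 1 $ 2 + a $ 2 $ 1 + a $ 2 $ 2) - 1)"
    by (simp add: matrix_vector_mult_def sum_3 algebra_simps)
  also have "\<dots> \<in> even_ideal n"
    unfolding S add_diff_cancel_left'
    by (intro even_ideal_add even_ideal_mult odd_local_add aR yJ two_mult_even_ideal odd_local_of_int)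
  finally show "of_real ((a *v y) $ 1 + (a *v y) $ 2) - 1 \<in> even_ideal n" .
qed

section \<open>Amalgams of subgroups\<close>

text \<open>A list \<open>[(b\<^sub>1, a\<^sub>1), \<dots>, (b\<^sub>k, a\<^sub>k)]\<close> stands for the product \<open>b\<^sub>1 a\<^sub>1 \<dots> b\<^sub>k a\<^sub>k\<close>; only the last \<open>a\<^sub>k\<close>
  may lie in \<open>A \<inter> B\<close>.\<close>

fun alternating :: "'a set \<Rightarrow> 'a set \<Rightarrow> ('a \<times> 'a) list \<Rightarrow> bool" where
  "alternating A B [] \<longleftrightarrow> True"
| "alternating A B ((b, a) # ds) \<longleftrightarrow> b \<in> B \<and> b \<notin> A \<and> a \<in> A \<and> (ds \<noteq> [] \<longrightarrow> a \<notin> B) \<and> alternating A B ds"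

text \<open>The leading letter from the first group is always written, possibly as the neutral
  element, so that normal forms have a single shape.\<close>

fun alternating_word :: "'a \<Rightarrow> ('a \<times> 'a) list \<Rightarrow> ('a + 'a) list" where
  "alternating_word a [] = [Inl a]"
| "alternating_word a ((b, a') # ds) = Inl a # Inr b # alternating_word a' ds"

lemma alternating_word_Cons: "\<exists>w. \<forall>a. alternating_word a ds = Inl a # w"
  by (cases ds) auto

context group
begin

fun alternating_prod :: "('a \<times> 'a) list \<Rightarrow> 'a" where
  "alternating_prod [] = \<one>"
| "alternating_prod ((b, a) # ds) = b \<otimes> (a \<otimes> alternating_prod ds)"

lemma alternating_prod_closed:
  assumes "A \<subseteq> carrier G" "B \<subseteq> carrier G" "alternating A B ds"
  shows "alternating_prod ds \<in> carrier G"
  using assms(3) by (induction ds rule: alternating_prod.induct) (use assms(1,2) in auto)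

context
  fixes A B
  assumes A: "subgroup A G" and B: "subgroup B G"
begin

private abbreviation (input) "GA \<equiv> G\<lparr>carrier := A\<rparr>"
private abbreviation (input) "GB \<equiv> G\<lparr>carrier := B\<rparr>"
private abbreviation (input) "GC \<equiv> G\<lparr>carrier := A \<inter> B\<rparr>"
private abbreviation (input) "W \<equiv> amalg_words GA GB"
private abbreviation (input) "E \<equiv> amalg_rel GA GB GC (\<lambda>x. x) (\<lambda>x. x)"
private abbreviation (input) "P \<equiv> amalg_product GA GB GC (\<lambda>x. x) (\<lambda>x. x)"

private lemmas factors = subgroup_imp_group[OF A] subgroup_imp_group[OF B]

private lemma incl_factors: "(\<lambda>x. x) \<in> carrier GC \<rightarrow> carrier GA" "(\<lambda>x. x) \<in> carrier GC \<rightarrow> carrier GB"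
  by auto

private lemma subset_factors: "A \<subseteq> carrier G" "B \<subseteq> carrier G"
  using A B by (auto dest: subgroup.subset)

lemma alternating_word_in:
  "a \<in> A \<Longrightarrow> alternating A B ds \<Longrightarrow> alternating_word a ds \<in> W"
  by (induction a ds rule: alternating_word.induct) (auto simp: amalg_words_def)

private lemma rel_Cons: "(u, v) \<in> E \<Longrightarrow> [x] \<in> W \<Longrightarrow> (x # u, x # v) \<in> E"
  using amalg_rel.cong[of u v GA GB GC "\<lambda>x. x" "\<lambda>x. x" "[x]" "[]"] by (auto simp: amalg_words_def)

private lemma rel_prefix: "(u, v) \<in> E \<Longrightarrow> w \<in> W \<Longrightarrow> (u @ w, v @ w) \<in> E"
  using amalg_rel.cong[of u v GA GB GC "\<lambda>x. x" "\<lambda>x. x" "[]" w] by (auto simp: amalg_words_def)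

private lemma rel_mult_l: "a \<in> A \<Longrightarrow> a' \<in> A \<Longrightarrow> w \<in> W \<Longrightarrow> (Inl a # Inl a' # w, Inl (a \<otimes> a') # w) \<in> E"
  using rel_prefix[OF amalg_rel.mult_l[of a GA a']] by simp

private lemma rel_mult_r: "b \<in> B \<Longrightarrow> b' \<in> B \<Longrightarrow> w \<in> W \<Longrightarrow> (Inr b # Inr b' # w, Inr (b \<otimes> b') # w) \<in> E"
  using rel_prefix[OF amalg_rel.mult_r[of b GB b']] by simp

private lemma rel_amalg: "c \<in> A \<Longrightarrow> c \<in> B \<Longrightarrow> w \<in> W \<Longrightarrow> (Inl c # w, Inr c # w) \<in> E"
  using rel_prefix[OF amalg_rel.amalg[of c GC]] by simp

private lemma rel_one_l: "w \<in> W \<Longrightarrow> (w, Inl \<one> # w) \<in> E"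
  using rel_prefix[OF amalg_rel.sym[OF amalg_rel.one_l]] by simp

private lemma letter_words [simp]:
  "Inl a # w \<in> W \<longleftrightarrow> a \<in> A \<and> w \<in> W" "Inr b # w \<in> W \<longleftrightarrow> b \<in> B \<and> w \<in> W" "[] \<in> W"
  by (auto simp: amalg_words_def)

private lemma prepend_l:
  assumes "a \<in> A" "a0 \<in> A" "alternating A B ds"
  shows "(Inl a # alternating_word a0 ds, alternating_word (a \<otimes> a0) ds) \<in> E"
proof -
  obtain w where w: "\<And>a. alternating_word a ds = Inl a # w" using alternating_word_Cons by blast
  then have "w \<in> W" using alternating_word_in[OF assms(2,3)] by simp
  then show ?thesis using assms rel_mult_l by (simp add: w)
qed

text \<open>A letter \<open>b\<close> in \<open>A\<close> is absorbed into the leading letter.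
  Otherwise it opens a new block, unless the leading letter \<open>a0\<close> lies in
  \<open>A \<inter> B\<close> and is followed by a block with first letter \<open>d\<close>: then
  \<open>b\<close>, \<open>a0\<close> and \<open>d\<close> merge into one letter of
  \<open>B\<close>, which either replaces \<open>d\<close> or, if it falls into \<open>A\<close>, is
  absorbed into the letter after \<open>d\<close>.\<close>

private lemma prepend_r:
  assumes b: "b \<in> B" and a0: "a0 \<in> A" and ds: "alternating A B ds"
  shows "\<exists>a\<in>A. \<exists>ds'. alternating A B ds' \<and> (Inr b # alternating_word a0 ds, alternating_word a ds') \<in> E"
proof (cases "b \<in> A")
  case True
  then have "(Inr b # alternating_word a0 ds, alternating_word (b \<otimes> a0) ds) \<in> E"
    using amalg_rel.trans[OF amalg_rel.sym[OF rel_amalg] prepend_l] b a0 ds alternating_word_in by blast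
  then show ?thesis using True a0 ds subgroup.m_closed[OF A] by blast
next
  case bA: False
  show ?thesis
  proof (cases "ds = [] \<or> a0 \<notin> B")
    case True
    then have "alternating A B ((b, a0) # ds)" using bA b a0 ds by auto
    moreover have "(Inr b # alternating_word a0 ds, alternating_word \<one> ((b, a0) # ds)) \<in> E"
      using rel_one_l b a0 ds alternating_word_in by simp
    ultimately show ?thesis using subgroup.one_closed[OF A] by blast
  next
    case False
    then obtain d a ds' where d: "ds = (d, a) # ds'" and a0B: "a0 \<in> B" by (metis neq_Nil_conv surj_pair)
    have da: "d \<in> B" "a \<in> A" "alternating A B ds'" "ds' \<noteq> [] \<longrightarrow> a \<notin> B" using ds by (auto simp: d)
    define w where "w = alternating_word a ds'"
    have w: "w \<in> W" using da by (auto simp: w_def intro: alternating_word_in)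
    define b' where "b' = b \<otimes> (a0 \<otimes> d)"
    have b': "b' \<in> B" using b a0B da(1) subgroup.m_closed[OF B] by (simp add: b'_def)
    have "(Inr b # Inl a0 # Inr d # w, Inr b # Inr a0 # Inr d # w) \<in> E"
      using b a0 a0B da w by (intro rel_Cons rel_amalg) auto
    then have "(Inr b # Inl a0 # Inr d # w, Inr b # Inr (a0 \<otimes> d) # w) \<in> E"
      using amalg_rel.trans[OF _ rel_Cons[OF rel_mult_r]] b a0B da(1) w by simp
    then have eq: "(Inr b # Inl a0 # Inr d # w, Inr b' # w) \<in> E"
      using amalg_rel.trans[OF _ rel_mult_r] b a0B da(1) w subgroup.m_closed[OF B] by (simp add: b'_def)
    have u: "Inr b # alternating_word a0 ds = Inr b # Inl a0 # Inr d # w" by (simp add: d w_def)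
    show ?thesis
    proof (cases "b' \<in> A")
      case True
      then have "(Inr b' # w, alternating_word (b' \<otimes> a) ds') \<in> E"
        unfolding w_def using amalg_rel.trans[OF amalg_rel.sym[OF rel_amalg] prepend_l] b' da
          alternating_word_in by blast
      then show ?thesis
        unfolding u using amalg_rel.trans[OF eq] True da subgroup.m_closed[OF A] by blast
    next
      case False
      then have "alternating A B ((b', a) # ds')" using b' da by simp
      moreover have "(Inr b' # w, alternating_word \<one> ((b', a) # ds')) \<in> E"
        using rel_one_l b' w by (simp add: w_def)
      ultimately show ?thesis
        unfolding u using amalg_rel.trans[OF eq] subgroup.one_closed[OF A] by blast
    qed
  qed
qed

lemma alternating_normal_form:
  "u \<in> W \<Longrightarrow> \<exists>a\<in>A. \<exists>ds. alternating A B ds \<and> (u, alternating_word a ds) \<in> E"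
proof (induction u)
  case Nil
  have "([], alternating_word \<one> []) \<in> E" using rel_one_l[of "[]"] by simp
  then show ?case using subgroup.one_closed[OF A] by (metis alternating.simps(1))
next
  case (Cons x u)
  then have u: "u \<in> W" and x: "[x] \<in> W" by (auto simp: amalg_words_def)
  obtain a ds where a: "a \<in> A" "alternating A B ds" and rel: "(u, alternating_word a ds) \<in> E"
    using Cons.IH[OF u] by blast
  have xu: "(x # u, x # alternating_word a ds) \<in> E" using rel_Cons[OF rel x] .
  show ?case
  proof (cases x)
    case (Inl a')
    then have "a' \<in> A" using x by simp
    then show ?thesis
      using amalg_rel.trans[OF xu] prepend_l a subgroup.m_closed[OF A] Inl by blast
  next
    case (Inr b)
    then have "b \<in> B" using x by simp
    then show ?thesis using amalg_rel.trans[OF xu] prepend_r a Inr by blast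
  qed
qed

text \<open>The universal property supplies the map, and its image is a subgroup containing both
  factors. If a word in normal form with leading letter \<open>a\<close> maps to the neutral
  element, its alternating part equals the inverse of \<open>a\<close> and thus lies in
  \<open>A\<close>; by \<open>free\<close> that part is empty, and then \<open>a\<close> is
  neutral.\<close>

lemma amalg_product_iso_generate:
  assumes free: "\<And>ds. alternating A B ds \<Longrightarrow> ds \<noteq> [] \<Longrightarrow> alternating_prod ds \<notin> A"
  shows "G\<lparr>carrier := generate G (A \<union> B)\<rparr> \<cong> P"
proof -
  let ?K = "generate G (A \<union> B)"
  let ?G = "G\<lparr>carrier := ?K\<rparr>"
  have K: "subgroup ?K G" using generate_is_subgroup subset_factors by blast
  have AK: "A \<subseteq> ?K" "B \<subseteq> ?K" by (auto intro: generate.incl)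
  have homs: "(\<lambda>x. x) \<in> hom GA ?G" "(\<lambda>x. x) \<in> hom GB ?G"
    using AK by (auto simp: hom_def)
  have gK: "group ?G" using subgroup_imp_group[OF K] .
  obtain h where h: "h \<in> hom P ?G" and hl: "\<And>a. a \<in> A \<Longrightarrow> h (E `` {[Inl a]}) = a"
    and hr: "\<And>b. b \<in> B \<Longrightarrow> h (E `` {[Inr b]}) = b"
    using amalg_product_universal[OF factors incl_factors gK homs] by auto
  have gP: "group P" using group_amalg_product[OF factors incl_factors] .
  interpret h: group_hom P ?G h using h gP gK by (simp add: group_hom_def group_hom_axioms_def)
  have carrP: "E `` {u} \<in> carrier P" if "u \<in> W" for u
    using that by (auto simp: amalg_product_def intro: quotientI)
  have h_append: "h (E `` {u @ v}) = h (E `` {u}) \<otimes> h (E `` {v})" if "u \<in> W" "v \<in> W" for u v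
    using hom_mult[OF h carrP[OF that(1)] carrP[OF that(2)]]
      amalg_mult_class[OF factors incl_factors that] by simp
  have h_word: "h (E `` {alternating_word a ds}) = a \<otimes> alternating_prod ds"
    if "a \<in> A" "alternating A B ds" for a ds
    using that
  proof (induction a ds rule: alternating_word.induct)
    case (1 a)
    then show ?case using hl subset_factors by auto
  next
    case (2 a b a' ds)
    then have w: "alternating_word a' ds \<in> W" by (auto intro: alternating_word_in)
    have "h (E `` {alternating_word a ((b, a') # ds)})
        = h (E `` {[Inl a]}) \<otimes> (h (E `` {[Inr b]}) \<otimes> h (E `` {alternating_word a' ds}))"
      using h_append[of "[Inl a]" "Inr b # alternating_word a' ds"]
        h_append[of "[Inr b]" "alternating_word a' ds"] 2 w by simp
    then show ?case using 2 hl hr by simp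
  qed
  have "inj_on h (carrier P)"
  proof (rule h.inj_on_one_iff[THEN iffD2], intro allI impI)
    fix U assume "U \<in> carrier P" and hU: "h U = \<one>\<^bsub>?G\<^esub>"
    then obtain u where u: "u \<in> W" "U = E `` {u}"
      by (auto simp: amalg_product_def elim: quotientE)
    obtain a ds where a: "a \<in> A" "alternating A B ds" and rel: "(u, alternating_word a ds) \<in> E"
      using alternating_normal_form[OF u(1)] by blast
    have U: "U = E `` {alternating_word a ds}"
      using u rel equiv_class_eq[OF equiv_amalg_rel[OF factors incl_factors]] by simp
    then have one: "a \<otimes> alternating_prod ds = \<one>" using h_word[OF a] hU by simp
    have aG: "a \<in> carrier G" "alternating_prod ds \<in> carrier G"
      using a subset_factors alternating_prod_closed[OF subset_factors] by auto
    then have "alternating_prod ds = inv a" using one by (metis inv_equality inv_inv inv_closed)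
    then have ds: "ds = []" using free[OF a(2)] subgroup.m_inv_closed[OF A a(1)] by auto
    then have "a = \<one>" using one aG by simp
    then have "([], alternating_word a ds) \<in> E" using ds rel_one_l[of "[]"] by simp
    then show "U = \<one>\<^bsub>P\<^esub>"
      using U equiv_class_eq[OF equiv_amalg_rel[OF factors incl_factors]]
      by (simp add: amalg_product_def)
  qed
  moreover have "h ` carrier P = carrier ?G"
  proof
    show "h ` carrier P \<subseteq> carrier ?G" using h.hom_closed by blast
    have "subgroup (h ` carrier P) ?G" by (rule h.img_is_subgroup)
    then have "subgroup (h ` carrier P) G" using K incl_subgroup by blast
    moreover have "A \<subseteq> h ` carrier P" using hl carrP[of "[Inl _]"] by force
    moreover have "B \<subseteq> h ` carrier P" using hr carrP[of "[Inr _]"] by force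
    ultimately show "carrier ?G \<subseteq> h ` carrier P" using generate_subgroup_incl by simp
  qed
  ultimately have "h \<in> iso P ?G" using h by (simp add: iso_def bij_betw_def)
  then show ?thesis using group.iso_sym[OF gP] is_isoI by blast
qed

end
end

section \<open>The structure of G(4,n)\<close>

text \<open>Induction from the right end of the product: \<open>c\<close> collects the reciprocals
  of the cosines, and \<open>cube_step\<close> turns the vector near u left by one block into an
  admissible input for \<open>dihedral_step\<close>.\<close>

lemma alternating_near_diagonal:
  assumes n: "n > 0" "4 dvd n"
    and ds: "alternating (carrier cube_group) (carrier (dihedral_rot n)) ds" "ds \<noteq> []"
  shows "\<exists>c y. of_real c \<in> even_ideal n \<and> (\<forall>i. y $ i \<in> \<int>) \<and>
    near_diagonal n (c *\<^sub>R (group.alternating_prod (SO3 \<real>) ds *v y))"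
proof -
  interpret group "SO3 \<real>" by (rule group_SO3_real)
  show ?thesis
    using ds
  proof (induction ds)
    case (Cons d ds)
    obtain b a where d: "d = (b, a)" by fastforce
    have b: "b \<in> carrier (dihedral_rot n)" "b \<notin> carrier cube_group" and a: "a \<in> carrier cube_group"
      using Cons.prems by (auto simp: d)
    show ?case
    proof (cases "ds = []")
      case True
      have s: "a $ i $ j \<in> {- 1, 0, 1}" for i j using a by (simp add: cube_group_iff)
      have o: "a ** transpose a = mat 1" using a by (simp add: cube_group_iff carrier_SO3_real)
      define y where "y = transpose a *v axis 1 1"
      have "y $ i = a $ 1 $ i" for i
        using exhaust_3[of i]
        by (auto simp: y_def matrix_vector_mult_def transpose_def axis_def sum_3
            simp del: transpose_matrix_vector)
      then have y: "y $ i \<in> \<int>" for i using s[of 1 i] by auto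
      have ay: "a *v y = axis 1 1"
        using o by (simp add: y_def matrix_vector_mul_assoc del: transpose_matrix_vector)
      have e1: "of_real ((axis 1 1 :: real^3) $ i) \<in> odd_local n" for i by (simp add: axis_def)
      obtain c where c: "of_real c \<in> even_ideal n" "near_diagonal n (c *\<^sub>R (b *v axis 1 1))"
        using dihedral_step[OF n b e1] by (auto simp: axis_def)
      have "alternating_prod (d # ds) *v y = b *v axis 1 1"
        by (simp add: True d ay flip: matrix_vector_mul_assoc)
      then show ?thesis using c y by metis
    next
      case False
      then have "a \<notin> carrier (dihedral_rot n)"
        "alternating (carrier cube_group) (carrier (dihedral_rot n)) ds"
        using Cons.prems by (auto simp: d)
      then have a33: "a $ 3 $ 3 = 0" using cube_fixing_z_axis_dihedral[OF n a] by blast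
      obtain c y where c: "of_real c \<in> even_ideal n" and y: "\<forall>i. y $ i \<in> \<int>"
        and near: "near_diagonal n (c *\<^sub>R (alternating_prod ds *v y))"
        using Cons.IH[OF _ False] \<open>alternating _ _ ds\<close> by blast
      obtain c' where c': "of_real c' \<in> even_ideal n"
        "near_diagonal n (c' *\<^sub>R (b *v (a *v (c *\<^sub>R (alternating_prod ds *v y)))))"
        using dihedral_step[OF n b cube_step[OF a a33 near]] by blast
      have "of_real (c' * c) \<in> even_ideal n"
        using even_ideal_mult[OF even_ideal_subset[OF c'(1)] c] by simp
      moreover have "c' *\<^sub>R (b *v (a *v (c *\<^sub>R (alternating_prod ds *v y))))
          = (c' * c) *\<^sub>R (alternating_prod (d # ds) *v y)"
        by (simp add: d matrix_vector_mult_scaleR flip: matrix_vector_mul_assoc)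
      ultimately show ?thesis using c'(2) y by metis
    qed
  qed simp
qed

lemma alternating_notin_cube_group:
  assumes n: "n > 0" "4 dvd n"
    and ds: "alternating (carrier cube_group) (carrier (dihedral_rot n)) ds" "ds \<noteq> []"
  shows "group.alternating_prod (SO3 \<real>) ds \<notin> carrier cube_group"
proof
  define M where "M = group.alternating_prod (SO3 \<real>) ds"
  assume "group.alternating_prod (SO3 \<real>) ds \<in> carrier cube_group"
  then have M: "M $ i $ j \<in> {- 1, 0, 1}" for i j by (simp add: cube_group_iff M_def)
  then have MZ: "M $ i $ j \<in> \<int>" for i j
    by (metis M Ints_0 Ints_1 Ints_minus emptyE insertE)
  obtain c y where c: "of_real c \<in> even_ideal n" and y: "\<forall>i. y $ i \<in> \<int>"
    and near: "near_diagonal n (c *\<^sub>R (M *v y))"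
    using alternating_near_diagonal[OF assms] unfolding M_def by blast
  have "(M *v y) $ 1 \<in> \<int>"
    using MZ y by (auto simp: matrix_vector_mult_def sum_3)
  then obtain k :: int where k: "(M *v y) $ 1 = of_int k" by (metis Ints_cases)
  have "of_int k * of_real c \<in> even_ideal n"
    by (rule even_ideal_mult[OF odd_local_of_int c])
  moreover have "of_real (c * of_int k) - 1 \<in> even_ideal n"
    using near k by (simp add: near_diagonal_def)
  ultimately have "of_int k * of_real c - (of_real (c * of_int k) - 1) \<in> even_ideal n"
    by (rule even_ideal_diff)
  then show False using one_notin_even_ideal[OF n(1)] by (simp add: mult.commute)
qed

lemma rot_z_quarter_mem:
  assumes "n > 0" "4 dvd n" "subgroup H (SO3 \<real>)" "rot_z (2 * pi / real n) \<in> H"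
  shows "rot_z (pi / 2) \<in> H"
proof -
  obtain k where k: "n = 4 * k" using assms(2) by blast
  have "rot_z (real k * (2 * pi / real n)) \<in> H" using rot_z_multiple_mem[OF assms(3,4)] .
  then show ?thesis using assms(1) by (simp add: k field_simps)
qed

lemma cube_group_subset_G4:
  assumes "n > 0" "4 dvd n"
  shows "carrier cube_group \<subseteq> carrier (G4 n)"
proof
  interpret group "SO3 \<real>" by (rule group_SO3_real)
  let ?H = "generate (SO3 \<real>) {rot_y (pi / 2), rot_z (2 * pi / real n)}"
  have H: "subgroup ?H (SO3 \<real>)" by (rule generate_is_subgroup) (simp add: rot_y_SO3 rot_z_SO3)
  have mem: "rot_y (pi / 2) \<in> ?H" "rot_z (2 * pi / real n) \<in> ?H" by (auto intro: generate.incl)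
  fix A assume "A \<in> carrier cube_group"
  then show "A \<in> carrier (G4 n)"
    using cube_group_generated[OF H mem(1) rot_z_quarter_mem[OF assms H mem(2)]]
    by (simp add: G4_def rotation_subgroup_def)
qed

text \<open>The generators match up because \<open>rot_x pi\<close> and
  \<open>rot_y (pi / 2)\<close> are cube rotations, and the whole cube group lies in G(4,n) once the
  quarter turn about the z-axis does.\<close>

lemma carrier_G4:
  assumes n: "n > 0" "4 dvd n"
  shows "carrier (G4 n) = generate (SO3 \<real>) (carrier cube_group \<union> carrier (dihedral_rot n))"
    (is "_ = generate _ (?A \<union> ?B)")
proof -
  interpret group "SO3 \<real>" by (rule group_SO3_real)
  have H: "subgroup (carrier (G4 n)) (SO3 \<real>)"
    unfolding G4_def rotation_subgroup_def
    using generate_is_subgroup[of "{rot_y (pi / 2), rot_z (2 * pi / real n)}"]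
    by (simp add: rot_y_SO3 rot_z_SO3)
  have zH: "rot_z (2 * pi / real n) \<in> carrier (G4 n)"
    by (auto simp: G4_def rotation_subgroup_def intro: generate.incl)
  have "?B \<subseteq> carrier (G4 n)"
    unfolding dihedral_rot_def rotation_subgroup_def
    using generate_subgroup_incl[OF _ H, of "{rot_z (2 * pi / real n), rot_x pi}"] zH rot_x_cube
      cube_group_subset_G4[OF n] by auto
  then have "generate (SO3 \<real>) (?A \<union> ?B) \<subseteq> carrier (G4 n)"
    using generate_subgroup_incl[OF _ H] cube_group_subset_G4[OF n] by simp
  moreover have "carrier (G4 n) \<subseteq> generate (SO3 \<real>) (?A \<union> ?B)"
    unfolding G4_def rotation_subgroup_def
    using mono_generate[of "{rot_y (pi / 2), rot_z (2 * pi / real n)}" "?A \<union> ?B"]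
      rot_y_cube rot_z_dihedral_rot[of n] by auto
  ultimately show ?thesis by blast
qed

lemma G4_iso_amalg_product:
  assumes n: "n > 0" "4 dvd n"
  shows "G4 n \<cong> amalg_product cube_group (dihedral_rot n) (cube_dihedral_inter n) (\<lambda>A. A) (\<lambda>A. A)"
proof -
  interpret group "SO3 \<real>" by (rule group_SO3_real)
  have eqs: "(SO3 \<real>)\<lparr>carrier := carrier cube_group\<rparr> = cube_group"
    "(SO3 \<real>)\<lparr>carrier := carrier (dihedral_rot n)\<rparr> = dihedral_rot n"
    "(SO3 \<real>)\<lparr>carrier := carrier cube_group \<inter> carrier (dihedral_rot n)\<rparr> = cube_dihedral_inter n"
    "(SO3 \<real>)\<lparr>carrier := carrier (G4 n)\<rparr> = G4 n"
    by (simp_all add: cube_group_def dihedral_rot_def cube_dihedral_inter_def G4_def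
        rotation_subgroup_def)
  show ?thesis
    using amalg_product_iso_generate[OF subgroup_cube_group subgroup_dihedral_rot
        alternating_notin_cube_group[OF n], of n]
    unfolding eqs carrier_G4[OF n, symmetric] .
qed

section \<open>The conjugation representation\<close>

lemma adjoin_one [simp]: "1 \<in> adjoin S"
  using generate_ring.one[of "ring_of_type_algebra :: complex ring" S]
  by (simp add: adjoin_def ring_of_type_algebra_def)

lemma adjoin_gen: "x \<in> S \<Longrightarrow> x \<in> adjoin S"
  by (simp add: adjoin_def generate_ring.incl)

lemma adjoin_add [intro]: "x \<in> adjoin S \<Longrightarrow> y \<in> adjoin S \<Longrightarrow> x + y \<in> adjoin S"
  using generate_ring.eng_add[of x "ring_of_type_algebra :: complex ring" S y]
  by (simp add: adjoin_def ring_of_type_algebra_def)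

lemma adjoin_mult [intro]: "x \<in> adjoin S \<Longrightarrow> y \<in> adjoin S \<Longrightarrow> x * y \<in> adjoin S"
  using generate_ring.eng_mult[of x "ring_of_type_algebra :: complex ring" S y]
  by (simp add: adjoin_def ring_of_type_algebra_def)

lemma ring_of_type_uminus: "\<ominus>\<^bsub>(ring_of_type_algebra :: complex ring)\<^esub> x = - x"
proof -
  interpret ring "ring_of_type_algebra :: complex ring" by (rule ring_from_type_algebra)
  show ?thesis by (rule minus_equality) (simp_all add: ring_of_type_algebra_def)
qed

lemma adjoin_minus [intro]: "x \<in> adjoin S \<Longrightarrow> - x \<in> adjoin S"
  using generate_ring.a_inv[of x "ring_of_type_algebra :: complex ring" S]
  by (simp add: adjoin_def ring_of_type_uminus)

lemma adjoin_zero [simp]: "0 \<in> adjoin S"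
  using adjoin_add[OF adjoin_one adjoin_minus[OF adjoin_one]] by simp

lemma adjoin_power [intro]: "x \<in> adjoin S \<Longrightarrow> x ^ k \<in> adjoin S"
  by (induction k) auto

lemma adjoin_induct [consumes 1, case_names one gen minus add mult]:
  assumes "x \<in> adjoin S" "P 1" "\<And>x. x \<in> S \<Longrightarrow> P x" "\<And>x. P x \<Longrightarrow> P (- x)"
    "\<And>x y. P x \<Longrightarrow> P y \<Longrightarrow> P (x + y)" "\<And>x y. P x \<Longrightarrow> P y \<Longrightarrow> P (x * y)"
  shows "P x"
  using assms(1) unfolding adjoin_def
proof induction
  case one
  then show ?case using assms(2) by (simp add: ring_of_type_algebra_def)
next
  case (incl x)
  then show ?case by (rule assms(3))
next
  case (a_inv x)
  then show ?case using assms(4) by (simp only: ring_of_type_uminus)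
next
  case (eng_add x y)
  then show ?case using assms(5) by (simp add: ring_of_type_algebra_def)
next
  case (eng_mult x y)
  then show ?case using assms(6) by (simp add: ring_of_type_algebra_def)
qed

lemma adjoin_mono:
  assumes "S \<subseteq> adjoin S'" shows "adjoin S \<subseteq> adjoin S'"
proof
  fix x assume "x \<in> adjoin S"
  then show "x \<in> adjoin S'" by (induction rule: adjoin_induct) (use assms in auto)
qed

lemma U2_simps [simp]: "x \<otimes>\<^bsub>U2 R\<^esub> y = x ** y" "\<one>\<^bsub>U2 R\<^esub> = mat 1"
  by (simp_all add: U2_def)

lemma dagger_unitary: "g ** dagger g = mat 1 \<Longrightarrow> dagger g ** g = mat 1"
  for g :: "complex^2^2"
  by (simp add: matrix_left_right_inverse)

text \<open>The inverse demanded by \<open>GL2\<close> is unique and therefore equal to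
  \<open>dagger g\<close>. As \<open>R\<close> is an arbitrary set, possibly not closed under
  conjugation, the entries of \<open>dagger g\<close> need a condition of their own.\<close>

lemma carrier_U2:
  "g \<in> carrier (U2 R) \<longleftrightarrow> g ** dagger g = mat 1 \<and> (\<forall>i j. g $ i $ j \<in> R) \<and> (\<forall>i j. dagger g $ i $ j \<in> R)"
proof
  assume "g \<in> carrier (U2 R)"
  then obtain h where g: "g ** dagger g = mat 1" "\<forall>i j. g $ i $ j \<in> R" "\<forall>i j. h $ i $ j \<in> R"
    "h ** g = mat 1" by (auto simp: U2_def GL2_def)
  then have "h = h ** (g ** dagger g)" by simp
  also have "\<dots> = (h ** g) ** dagger g" by (simp only: matrix_mul_assoc)
  also have "\<dots> = dagger g" by (simp only: g matrix_mul_lid)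
  finally show "g ** dagger g = mat 1 \<and> (\<forall>i j. g $ i $ j \<in> R) \<and> (\<forall>i j. dagger g $ i $ j \<in> R)"
    using g by simp
next
  assume "g ** dagger g = mat 1 \<and> (\<forall>i j. g $ i $ j \<in> R) \<and> (\<forall>i j. dagger g $ i $ j \<in> R)"
  then show "g \<in> carrier (U2 R)" using dagger_unitary[of g] by (auto simp: U2_def GL2_def)
qed

lemma dagger_one [simp]: "dagger (mat 1) = mat 1"
  by (simp add: dagger_def mat_def vec_eq_iff)

lemma unitary_mult:
  fixes g h :: "complex^2^2"
  assumes "g ** dagger g = mat 1" "h ** dagger h = mat 1"
  shows "(g ** h) ** dagger (g ** h) = mat 1"
  by (metis assms dagger_mult matrix_mul_assoc matrix_mul_rid)

lemma adjoin_matrix_mult: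
  fixes g h :: "complex^2^2"
  assumes "\<forall>i j. g $ i $ j \<in> adjoin S" "\<forall>i j. h $ i $ j \<in> adjoin S"
  shows "(g ** h) $ i $ j \<in> adjoin S"
proof -
  have "(g ** h) $ i $ j = g $ i $ 1 * h $ 1 $ j + g $ i $ 2 * h $ 2 $ j"
    by (simp add: matrix_matrix_mult_def sum_2)
  then show ?thesis using assms by (simp add: adjoin_add adjoin_mult)
qed

lemma group_U2: "group (U2 (adjoin S))"
proof (rule groupI)
  fix g h assume "g \<in> carrier (U2 (adjoin S))" "h \<in> carrier (U2 (adjoin S))"
  then show "g \<otimes>\<^bsub>U2 (adjoin S)\<^esub> h \<in> carrier (U2 (adjoin S))"
    using unitary_mult by (simp add: carrier_U2 adjoin_matrix_mult dagger_mult)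
next
  show "\<one>\<^bsub>U2 (adjoin S)\<^esub> \<in> carrier (U2 (adjoin S))"
    by (simp add: carrier_U2) (simp add: mat_def)
next
  fix g assume g: "g \<in> carrier (U2 (adjoin S))"
  then have "dagger g \<in> carrier (U2 (adjoin S))" by (simp add: carrier_U2 dagger_unitary)
  moreover have "dagger g ** g = mat 1" using g by (simp add: carrier_U2 dagger_unitary)
  ultimately show "\<exists>h\<in>carrier (U2 (adjoin S)). h \<otimes>\<^bsub>U2 (adjoin S)\<^esub> g = \<one>\<^bsub>U2 (adjoin S)\<^esub>" by auto
qed (auto simp: matrix_mul_assoc carrier_U2)

section \<open>Conjugation of Pauli matrices as a rotation\<close>

lemma inj_pauli_vec: "inj pauli_vec"
  using bij_betw_pauli_vec by (simp add: bij_betw_def)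

lemma pauli_vec_entries:
  "pauli_vec v $ 1 $ 1 = of_real (v $ 3)" "pauli_vec v $ 2 $ 2 = - of_real (v $ 3)"
  "pauli_vec v $ 1 $ 2 = of_real (v $ 1) - \<i> * of_real (v $ 2)"
  "pauli_vec v $ 2 $ 1 = of_real (v $ 1) + \<i> * of_real (v $ 2)"
  by (simp_all add: pauli_defs complex_eq_iff)

lemma pauli_vec_rep:
  assumes "g ** dagger g = mat 1"
  shows "pauli_vec (pi_rep g *v v) = g ** pauli_vec v ** dagger g"
  using pauli_vec_pi_rep[OF assms] matrix_inv_unitary[OF assms] by simp

lemma pi_rep_eqI:
  assumes "g ** dagger g = mat 1" "\<And>v. pauli_vec (A *v v) = g ** pauli_vec v ** dagger g"
  shows "pi_rep g = A"
proof -
  have "pi_rep g *v v = A *v v" for v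
    using assms(2) pauli_vec_rep[OF assms(1)] inj_pauli_vec by (metis injD)
  then show ?thesis by (simp add: matrix_eq)
qed

text \<open>Expresses the Euclidean length through matrix multiplication, which conjugation
  respects; hence \<open>pi_rep\<close> acts by isometries.\<close>

lemma pauli_vec_square: "pauli_vec v ** pauli_vec v = mat (of_real (v \<bullet> v))"
  by (simp add: vec_eq_iff forall_2 matrix_matrix_mult_def sum_2 pauli_vec_entries mat_def
      inner_vec_def sum_3 complex_eq_iff algebra_simps)

lemma unitary_conj_scalar:
  fixes g :: "complex^2^2"
  assumes "g ** dagger g = mat 1" shows "g ** mat c ** dagger g = mat c"
proof -
  have "g ** mat c = mat c ** g"
    by (simp add: vec_eq_iff forall_2 matrix_matrix_mult_def sum_2 mat_def mult.commute)
  then show ?thesis using assms by (simp flip: matrix_mul_assoc)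
qed

lemma norm_pi_rep:
  assumes g: "g ** dagger g = mat 1"
  shows "norm (pi_rep g *v v) = norm v"
proof -
  let ?w = "pi_rep g *v v"
  have "mat (of_real (?w \<bullet> ?w)) = g ** pauli_vec v ** (dagger g ** g) ** pauli_vec v ** dagger g"
    by (simp only: pauli_vec_square[symmetric] pauli_vec_rep[OF g] matrix_mul_assoc)
  also have "\<dots> = g ** (pauli_vec v ** pauli_vec v) ** dagger g"
    by (simp add: dagger_unitary[OF g] matrix_mul_assoc)
  also have "\<dots> = mat (of_real (v \<bullet> v))"
    by (simp only: pauli_vec_square unitary_conj_scalar[OF g])
  finally have "?w \<bullet> ?w = v \<bullet> v" by (simp add: mat_def vec_eq_iff forall_2)
  then show ?thesis by (simp add: norm_eq_sqrt_inner)
qed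

text \<open>The relation \<open>\<sigma>\<^sub>x \<sigma>\<^sub>y = \<i> \<sigma>\<^sub>z\<close> is preserved by conjugation, so the third column of \<open>pi_rep g\<close> is
  the cross product of the first two.\<close>

lemma pi_rep_SO3:
  assumes g: "g ** dagger g = mat 1"
  shows "pi_rep g \<in> carrier (SO3 \<real>)"
proof -
  define A where "A = pi_rep g"
  have "orthogonal_transformation ((*v) A)"
    using norm_pi_rep[OF g] by (simp add: orthogonal_transformation A_def)
  then have o: "transpose A ** A = mat 1" "A ** transpose A = mat 1"
    by (simp_all add: orthogonal_transformation_matrix orthogonal_matrix_def)
  define e :: "3 \<Rightarrow> real^3" where "e j = axis j 1" for j
  define m where "m j = pauli_vec (A *v e j)" for j
  have conj: "m j = g ** pauli_vec (e j) ** dagger g" for j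
    unfolding m_def A_def by (rule pauli_vec_rep[OF g])
  have "pauli_vec (e 1) ** pauli_vec (e 2) = mat \<i> ** pauli_vec (e 3)"
    by (simp add: vec_eq_iff forall_2 matrix_matrix_mult_def sum_2 pauli_vec_entries mat_def e_def axis_def)
  have "m 1 ** m 2 = g ** pauli_vec (e 1) ** (dagger g ** g) ** pauli_vec (e 2) ** dagger g"
    by (simp only: conj matrix_mul_assoc)
  also have "\<dots> = g ** (pauli_vec (e 1) ** pauli_vec (e 2)) ** dagger g"
    by (simp add: dagger_unitary[OF g] matrix_mul_assoc)
  also have "\<dots> = g ** (mat \<i> ** pauli_vec (e 3)) ** dagger g"
    by (simp only: \<open>pauli_vec (e 1) ** pauli_vec (e 2) = _\<close>)
  also have "\<dots> = g ** mat \<i> ** (dagger g ** g) ** pauli_vec (e 3) ** dagger g"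
    by (simp add: dagger_unitary[OF g] matrix_mul_assoc)
  also have "\<dots> = (g ** mat \<i> ** dagger g) ** m 3"
    by (simp only: conj matrix_mul_assoc)
  also have "\<dots> = mat \<i> ** m 3" by (simp only: unitary_conj_scalar[OF g])
  finally have rel: "m 1 ** m 2 = mat \<i> ** m 3" .
  have col: "(A *v e j) $ i = A $ i $ j" for i j
    using exhaust_3[of j] by (auto simp: e_def axis_def matrix_vector_mult_def sum_3)
  from rel have "(m 1 ** m 2) $ 1 $ 1 = (mat \<i> ** m 3) $ 1 $ 1" "(m 1 ** m 2) $ 1 $ 2 = (mat \<i> ** m 3) $ 1 $ 2"
    by simp_all
  then have c: "A $ 3 $ 3 = A $ 1 $ 1 * A $ 2 $ 2 - A $ 2 $ 1 * A $ 1 $ 2"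
    "A $ 2 $ 3 = A $ 3 $ 1 * A $ 1 $ 2 - A $ 1 $ 1 * A $ 3 $ 2"
    "A $ 1 $ 3 = A $ 2 $ 1 * A $ 3 $ 2 - A $ 3 $ 1 * A $ 2 $ 2"
    by (simp_all add: m_def pauli_vec_entries col matrix_matrix_mult_def sum_2 mat_def complex_eq_iff)
  \<comment> \<open>The determinant is the inner product of the third column with the cross product
    of the first two, which by \<open>c\<close> is the third column again.\<close>
  have "det A = A $ 1 $ 3 * A $ 1 $ 3 + A $ 2 $ 3 * A $ 2 $ 3 + A $ 3 $ 3 * A $ 3 $ 3"
    unfolding c by (simp add: det_3 c algebra_simps)
  also have "\<dots> = 1" using o(1) by (simp add: matrix3_simps)
  finally show ?thesis using o(2) by (simp add: carrier_SO3_real A_def)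
qed

lemma pi_rep_scalar:
  assumes "mat c ** dagger (mat c) = (mat 1 :: complex^2^2)"
  shows "pi_rep (mat c) = mat 1"
proof (rule pi_rep_eqI[OF assms])
  fix v
  have "mat c ** pauli_vec v = pauli_vec v ** mat c"
    by (simp add: vec_eq_iff forall_2 matrix_matrix_mult_def sum_2 mat_def)
  then have "mat c ** pauli_vec v ** dagger (mat c) = pauli_vec v ** (mat c ** dagger (mat c))"
    by (simp add: matrix_mul_assoc)
  then show "pauli_vec (mat 1 *v v) = mat c ** pauli_vec v ** dagger (mat c)"
    by (simp add: assms)
qed

text \<open>Such a \<open>g\<close> commutes with all Pauli matrices: commuting with
  \<open>pauli_z\<close> makes it diagonal, and commuting with \<open>pauli_x\<close> makes the
  diagonal entries equal.\<close>

lemma pi_rep_trivial: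
  assumes g: "g ** dagger g = mat 1" and 1: "pi_rep g = mat 1"
  shows "\<exists>c. g = mat c"
proof -
  have comm: "pauli_vec v ** g = g ** pauli_vec v" for v
  proof -
    have "pauli_vec v = g ** pauli_vec v ** dagger g" using pauli_vec_rep[OF g, of v] 1 by simp
    then have "pauli_vec v ** g = g ** pauli_vec v ** (dagger g ** g)"
      by (metis matrix_mul_assoc)
    then show ?thesis by (simp add: dagger_unitary[OF g])
  qed
  have entry: "(pauli_vec v ** g) $ i $ j = (g ** pauli_vec v) $ i $ j" for v i j
    by (simp only: comm)
  have "g $ 1 $ 2 = - g $ 1 $ 2" "- g $ 2 $ 1 = g $ 2 $ 1"
    using entry[of "axis 3 1" 1 2] entry[of "axis 3 1" 2 1]
    by (simp_all add: matrix_matrix_mult_def sum_2 pauli_vec_entries axis_def)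
  then have "g $ 1 $ 2 = 0" "g $ 2 $ 1 = 0"
    by (simp_all add: eq_neg_iff_add_eq_0 neg_eq_iff_add_eq_0)
  moreover have "g $ 1 $ 1 = g $ 2 $ 2"
    using entry[of "axis 1 1" 1 2]
    by (simp add: matrix_matrix_mult_def sum_2 pauli_vec_entries axis_def)
  ultimately have "g = mat (g $ 1 $ 1)" by (simp add: vec_eq_iff forall_2 mat_def)
  then show ?thesis by blast
qed

section \<open>The image of the Clifford group\<close>

text \<open>Modulo 4 a square is 0 or 1 according to parity, and three such residues add up to 0
  only if all of them are 0.\<close>

lemma four_dvd_sum_squares:
  fixes a b c :: int
  assumes "4 dvd a * a + b * b + c * c"
  shows "even a \<and> even b \<and> even c"
proof -
  have sq: "\<exists>q. x * x = 4 * q + x mod 2" for x :: int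
  proof (cases "even x")
    case True
    then obtain y where "x = 2 * y" by blast
    then show ?thesis by (intro exI[of _ "y * y"]) simp
  next
    case False
    then obtain y where "x = 2 * y + 1" by (rule oddE)
    then show ?thesis by (intro exI[of _ "y * y + y"]) (simp add: algebra_simps)
  qed
  obtain p q r where "a * a = 4 * p + a mod 2" "b * b = 4 * q + b mod 2" "c * c = 4 * r + c mod 2"
    using sq by metis
  then show ?thesis using assms by presburger
qed

lemma sum_squares_power_four:
  fixes a b c :: int
  assumes "a * a + b * b + c * c = 4 ^ k"
  shows "2 ^ k dvd a \<and> 2 ^ k dvd b \<and> 2 ^ k dvd c"
  using assms
proof (induction k arbitrary: a b c)
  case (Suc k)
  then have "even a \<and> even b \<and> even c" by (intro four_dvd_sum_squares) simp
  then obtain a' b' c' where e: "a = 2 * a'" "b = 2 * b'" "c = 2 * c'" by blast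
  then have "a' * a' + b' * b' + c' * c' = 4 ^ k" using Suc.prems by simp
  then show ?case using Suc.IH by (simp add: e)
qed simp

section \<open>Dyadic rationals and Gaussian dyadic numbers\<close>

definition dyadic :: "real set" where
  "dyadic = {x. \<exists>(a::int) k. x = of_int a / 2 ^ k}"

lemma dyadic_of_int [simp]: "of_int a \<in> dyadic"
  unfolding dyadic_def by (intro CollectI exI[of _ a] exI[of _ 0]) simp

lemma dyadic_zero [simp]: "0 \<in> dyadic" and dyadic_one [simp]: "1 \<in> dyadic"
  using dyadic_of_int[of 0] dyadic_of_int[of 1] by simp_all

lemma dyadic_half [simp]: "1 / 2 \<in> dyadic"
  unfolding dyadic_def by (intro CollectI exI[of _ 1] exI[of _ 1]) simp

lemma dyadic_add: "x \<in> dyadic \<Longrightarrow> y \<in> dyadic \<Longrightarrow> x + y \<in> dyadic"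
proof -
  assume "x \<in> dyadic" "y \<in> dyadic"
  then obtain a b :: int and k l where "x = of_int a / 2 ^ k" "y = of_int b / 2 ^ l"
    by (auto simp: dyadic_def)
  then have "x + y = of_int (a * 2 ^ l + b * 2 ^ k) / 2 ^ (k + l)"
    by (simp add: add_frac_eq power_add)
  then show ?thesis unfolding dyadic_def by blast
qed

lemma dyadic_mult: "x \<in> dyadic \<Longrightarrow> y \<in> dyadic \<Longrightarrow> x * y \<in> dyadic"
proof -
  assume "x \<in> dyadic" "y \<in> dyadic"
  then obtain a b :: int and k l where "x = of_int a / 2 ^ k" "y = of_int b / 2 ^ l"
    by (auto simp: dyadic_def)
  then have "x * y = of_int (a * b) / 2 ^ (k + l)" by (simp add: power_add)
  then show ?thesis unfolding dyadic_def by blast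
qed

lemma dyadic_minus: "x \<in> dyadic \<Longrightarrow> - x \<in> dyadic"
  using dyadic_mult[OF dyadic_of_int[of "- 1"], of x] by simp

lemma dyadic_common_denominator:
  assumes "x \<in> dyadic" "y \<in> dyadic" "z \<in> dyadic"
  obtains a b c :: int and k where
    "x = of_int a / 2 ^ k" "y = of_int b / 2 ^ k" "z = of_int c / 2 ^ k"
proof -
  obtain a b c :: int and k l m where "x = of_int a / 2 ^ k" "y = of_int b / 2 ^ l" "z = of_int c / 2 ^ m"
    using assms by (auto simp: dyadic_def)
  then have "x = of_int (a * 2 ^ l * 2 ^ m) / 2 ^ (k + l + m)"
    "y = of_int (b * 2 ^ k * 2 ^ m) / 2 ^ (k + l + m)"
    "z = of_int (c * 2 ^ k * 2 ^ l) / 2 ^ (k + l + m)"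
    by (simp_all add: power_add)
  then show ?thesis by (rule that)
qed

lemma dyadic_unit_vector:
  assumes d: "x \<in> dyadic" "y \<in> dyadic" "z \<in> dyadic" and 1: "x * x + y * y + z * z = 1"
  shows "x \<in> {- 1, 0, 1} \<and> y \<in> {- 1, 0, 1} \<and> z \<in> {- 1, 0, 1}"
proof -
  obtain a b c :: int and k where abc: "x = of_int a / 2 ^ k" "y = of_int b / 2 ^ k" "z = of_int c / 2 ^ k"
    using dyadic_common_denominator[OF d] by metis
  have "real_of_int (a * a + b * b + c * c) / (2 ^ k * 2 ^ k) = 1"
    using 1 by (simp add: abc add_divide_distrib)
  then have "real_of_int (a * a + b * b + c * c) = 2 ^ k * 2 ^ k" by simp
  also have "\<dots> = real_of_int (4 ^ k)" by (simp flip: power_mult_distrib)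
  finally have "a * a + b * b + c * c = 4 ^ k" by (simp only: of_int_eq_iff)
  then obtain a' b' c' where "a = 2 ^ k * a'" "b = 2 ^ k * b'" "c = 2 ^ k * c'"
    using sum_squares_power_four by (metis dvdE)
  then have xyz: "x = of_int a'" "y = of_int b'" "z = of_int c'" by (simp_all add: abc)
  have "\<bar>t\<bar> \<le> 1" if "t * t \<le> 1" for t :: real
    using that by (metis abs_square_le_1 power2_eq_square)
  moreover have "x * x \<le> 1" "y * y \<le> 1" "z * z \<le> 1"
    using 1 zero_le_square[of x] zero_le_square[of y] zero_le_square[of z] by linarith+
  ultimately have "\<bar>x\<bar> \<le> 1" "\<bar>y\<bar> \<le> 1" "\<bar>z\<bar> \<le> 1" by blast+
  then have "\<bar>a'\<bar> \<le> 1" "\<bar>b'\<bar> \<le> 1" "\<bar>c'\<bar> \<le> 1" unfolding xyz by linarith+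
  then have "a' \<in> {- 1, 0, 1}" "b' \<in> {- 1, 0, 1}" "c' \<in> {- 1, 0, 1}" by auto
  then show ?thesis unfolding xyz by auto
qed

text \<open>The ring Z[i,1/2] in coordinates, so that the real entries of \<open>pi_rep g\<close>
  can be read off from a complex matrix.\<close>

definition gaussian_dyadic :: "complex set" where
  "gaussian_dyadic = {z. Re z \<in> dyadic \<and> Im z \<in> dyadic}"

lemma gaussian_dyadic_add: "x \<in> gaussian_dyadic \<Longrightarrow> y \<in> gaussian_dyadic \<Longrightarrow> x + y \<in> gaussian_dyadic"
  by (simp add: gaussian_dyadic_def dyadic_add)

lemma gaussian_dyadic_minus: "x \<in> gaussian_dyadic \<Longrightarrow> - x \<in> gaussian_dyadic"
  by (simp add: gaussian_dyadic_def dyadic_minus)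

lemma gaussian_dyadic_mult: "x \<in> gaussian_dyadic \<Longrightarrow> y \<in> gaussian_dyadic \<Longrightarrow> x * y \<in> gaussian_dyadic"
  using dyadic_add[OF dyadic_mult dyadic_minus[OF dyadic_mult], of "Re x" "Re y" "Im x" "Im y"]
    dyadic_add[OF dyadic_mult dyadic_mult, of "Re x" "Im y" "Im x" "Re y"]
  by (simp add: gaussian_dyadic_def)

lemma adjoin_gaussian_dyadic: "x \<in> adjoin {\<i>, 1 / 2} \<Longrightarrow> x \<in> gaussian_dyadic"
proof (induction rule: adjoin_induct)
  case one
  then show ?case by (simp add: gaussian_dyadic_def)
next
  case (gen x)
  moreover have "\<i> \<in> gaussian_dyadic" "1 / 2 \<in> gaussian_dyadic" by (simp_all add: gaussian_dyadic_def)
  ultimately show ?case by blast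
qed (simp_all add: gaussian_dyadic_add gaussian_dyadic_minus gaussian_dyadic_mult)

lemma gaussian_dyadic_matrix_mult:
  fixes g h :: "complex^2^2"
  assumes "\<And>i j. g $ i $ j \<in> gaussian_dyadic" "\<And>i j. h $ i $ j \<in> gaussian_dyadic"
  shows "(g ** h) $ i $ j \<in> gaussian_dyadic"
proof -
  have "(g ** h) $ i $ j = g $ i $ 1 * h $ 1 $ j + g $ i $ 2 * h $ 2 $ j"
    by (simp add: matrix_matrix_mult_def sum_2)
  then show ?thesis using assms by (simp add: gaussian_dyadic_add gaussian_dyadic_mult)
qed

lemma pi_rep_Clifford_cube:
  assumes g: "g \<in> Clifford"
  shows "pi_rep g \<in> carrier cube_group"
proof -
  define A where "A = pi_rep g"
  have u: "g ** dagger g = mat 1" and gd: "g $ i $ j \<in> gaussian_dyadic" "dagger g $ i $ j \<in> gaussian_dyadic" for i j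
    using g adjoin_gaussian_dyadic by (auto simp: Clifford_def carrier_U2)
  have A: "A \<in> carrier (SO3 \<real>)" unfolding A_def by (rule pi_rep_SO3[OF u])
  have ent: "A $ i $ j \<in> dyadic" for i j
  proof -
    have "pauli_vec (axis j 1) $ k $ l \<in> gaussian_dyadic" for k l
      using exhaust_2[of k] exhaust_2[of l] dyadic_of_int[of "- 1"]
      by (auto simp: pauli_vec_entries gaussian_dyadic_def axis_def)
    then have "(g ** pauli_vec (axis j 1) ** dagger g) $ k $ l \<in> gaussian_dyadic" for k l
      using gd by (intro gaussian_dyadic_matrix_mult)
    then have p: "pauli_vec (A *v axis j 1) $ k $ l \<in> gaussian_dyadic" for k l
      unfolding A_def pauli_vec_rep[OF u] .
    have col: "(A *v axis j 1) $ i = A $ i $ j" for i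
      using exhaust_3[of j] by (auto simp: axis_def matrix_vector_mult_def sum_3)
    have "A $ 3 $ j \<in> dyadic" using p[of 1 1] by (simp add: pauli_vec_entries gaussian_dyadic_def col)
    moreover have "A $ 1 $ j \<in> dyadic" "A $ 2 $ j \<in> dyadic"
      using p[of 2 1] by (simp_all add: pauli_vec_entries gaussian_dyadic_def col)
    ultimately show ?thesis using exhaust_3[of i] by auto
  qed
  have "A ** transpose A = mat 1" using A by (simp add: carrier_SO3_real)
  then have "(A ** transpose A) $ i $ i = 1" for i by (simp add: mat_def)
  then have "A $ i $ 1 * A $ i $ 1 + A $ i $ 2 * A $ i $ 2 + A $ i $ 3 * A $ i $ 3 = 1" for i
    by (simp add: matrix_matrix_mult_def transpose_def sum_3)
  then have row: "A $ i $ 1 \<in> {- 1, 0, 1} \<and> A $ i $ 2 \<in> {- 1, 0, 1} \<and> A $ i $ 3 \<in> {- 1, 0, 1}" for i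
    by (intro dyadic_unit_vector ent)
  have "A $ i $ j \<in> {- 1, 0, 1}" for i j using exhaust_3[of j] row[of i] by metis
  then show ?thesis using A by (simp add: cube_group_iff A_def)
qed

section \<open>Rotations belonging to the generating gates\<close>

lemma zeta_cis: "zeta n = cis (2 * pi / real n)"
  by (simp add: zeta_def cis_conv_exp mult_ac)

lemma zeta_power:
  assumes "n = 4 * k" "k > 0" shows "zeta n ^ k = \<i>"
  using assms by (simp add: zeta_cis Complex.DeMoivre complex_eq_iff)

lemma T_gate_unitary: "T_gate n ** dagger (T_gate n) = mat 1"
  by (simp add: vec_eq_iff forall_2 matrix_matrix_mult_def sum_2 T_gate_def dagger_def mat_def
      zeta_cis cis_cnj cis_mult)

lemma pi_rep_T_gate: "pi_rep (T_gate n) = rot_z (2 * pi / real n)"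
proof (rule pi_rep_eqI[OF T_gate_unitary])
  fix v :: "real^3"
  define t where "t = 2 * pi / real n"
  have z: "zeta n = cis t" by (simp add: zeta_cis t_def)
  have 1: "cos t * (cos t * v $ 3) + sin t * (sin t * v $ 3) = v $ 3"
    by (simp flip: mult.assoc distrib_right)
  show "pauli_vec (rot_z (2 * pi / real n) *v v) = T_gate n ** pauli_vec v ** dagger (T_gate n)"
    unfolding t_def[symmetric]
    by (simp add: z 1 vec_eq_iff forall_2 matrix_matrix_mult_def matrix_vector_mult_def sum_2 sum_3
        pauli_vec_entries T_gate_def dagger_def rot_z_def complex_eq_iff
        algebra_simps)
qed

text \<open>\<open>exp (- \<i> \<pi> \<sigma>\<^sub>y / 4)\<close> times the phase \<open>exp (\<i> \<pi> / 4)\<close>, which clears \<open>\<surd>2\<close> from the entries.\<close>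

definition y_gate :: "complex^2^2" where
  "y_gate = vector [vector [(1 + \<i>) / 2, - (1 + \<i>) / 2], vector [(1 + \<i>) / 2, (1 + \<i>) / 2]]"

lemma y_gate_unitary: "y_gate ** dagger y_gate = mat 1"
  by (simp add: vec_eq_iff forall_2 matrix_matrix_mult_def sum_2 y_gate_def dagger_def mat_def
      complex_eq_iff)

lemma pi_rep_y_gate: "pi_rep y_gate = rot_y (pi / 2)"
proof (rule pi_rep_eqI[OF y_gate_unitary])
  fix v :: "real^3"
  show "pauli_vec (rot_y (pi / 2) *v v) = y_gate ** pauli_vec v ** dagger y_gate"
    by (simp add: vec_eq_iff forall_2 matrix_matrix_mult_def matrix_vector_mult_def sum_2 sum_3
        pauli_vec_entries y_gate_def dagger_def rot_y_def complex_eq_iff)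
      (simp add: diff_divide_distrib add_divide_distrib)
qed

lemma y_gate_Clifford: "y_gate \<in> Clifford"
proof -
  let ?R = "adjoin {\<i>, 1 / 2}"
  have h: "1 / 2 \<in> ?R" "\<i> \<in> ?R" by (auto intro: adjoin_gen)
  have "(1 + \<i>) * (1 / 2) \<in> ?R" "(1 + - \<i>) * (1 / 2) \<in> ?R"
    by (intro adjoin_mult adjoin_add adjoin_minus adjoin_one h)+
  then have p: "(1 + \<i>) / 2 \<in> ?R" "(1 - \<i>) / 2 \<in> ?R" by simp_all
  then have m: "- ((1 + \<i>) / 2) \<in> ?R" "- ((1 - \<i>) / 2) \<in> ?R" by blast+
  have y: "y_gate $ 1 $ 1 = (1 + \<i>) / 2" "y_gate $ 1 $ 2 = - ((1 + \<i>) / 2)"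
    "y_gate $ 2 $ 1 = (1 + \<i>) / 2" "y_gate $ 2 $ 2 = (1 + \<i>) / 2"
    by (simp_all add: y_gate_def)
  have c: "cnj ((1 + \<i>) / 2) = (1 - \<i>) / 2" "cnj (- ((1 + \<i>) / 2)) = - ((1 - \<i>) / 2)"
    by (simp_all add: complex_eq_iff)
  have "y_gate $ i $ j \<in> ?R \<and> cnj (y_gate $ j $ i) \<in> ?R" for i j
    using exhaust_2[of i] exhaust_2[of j] by (elim disjE; simp only: y c p m simp_thms)
  then have "y_gate $ i $ j \<in> ?R \<and> dagger y_gate $ i $ j \<in> ?R" for i j
    by (simp add: dagger_def)
  then show ?thesis by (simp add: Clifford_def carrier_U2 y_gate_unitary)
qed

section \<open>The homomorphism on the Clifford-cyclotomic group\<close>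

lemma kernel_pi_rep: "kernel (U2 (adjoin S)) (SO3 \<real>) pi_rep = U2_scalars (adjoin S)"
  using pi_rep_trivial pi_rep_scalar by (auto simp: kernel_def U2_scalars_def carrier_U2)

lemma group_hom_pi_rep: "group_hom (U2 (adjoin S)) (SO3 \<real>) pi_rep"
proof -
  have "pi_rep \<in> hom (U2 (adjoin S)) (SO3 \<real>)"
    by (rule homI) (auto simp: carrier_U2 pi_rep_SO3 pi_rep_mult)
  then show ?thesis
    using group_U2 group_SO3_real by (simp add: group_hom_def group_hom_axioms_def)
qed

text \<open>For n = 4 k, the numbers \<i> = zeta^k and the conjugate zeta^(n-1) are powers of zeta,
  so the coefficients of the Clifford group and of the adjoint of \<open>T_gate n\<close> belong to
  \<open>Rn n\<close>.\<close>

lemma generators_in_U2: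
  assumes n: "n > 0" "4 dvd n"
  shows "Clifford \<union> {T_gate n} \<subseteq> carrier (U2 (Rn n))"
proof -
  obtain k where k: "n = 4 * k" "k > 0" using n by auto
  have z: "zeta n \<in> Rn n" "1 / 2 \<in> Rn n" by (simp_all add: Rn_def adjoin_gen)
  then have "zeta n ^ k \<in> Rn n" unfolding Rn_def by blast
  then have "\<i> \<in> Rn n" using zeta_power[OF k] by simp
  then have sub: "adjoin {\<i>, 1 / 2} \<subseteq> Rn n" using z unfolding Rn_def by (intro adjoin_mono) auto
  have cz: "cnj (zeta n) \<in> Rn n"
  proof -
    have "zeta n ^ (n - 1) * zeta n = zeta n ^ n" using n by (simp add: power_eq_if)
    also have "\<dots> = (zeta n ^ k) ^ 4" by (simp add: k mult.commute flip: power_mult)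
    also have "\<dots> = 1" by (simp add: zeta_power[OF k])
    also have "\<dots> = cnj (zeta n) * zeta n" by (simp add: zeta_cis cis_cnj cis_mult)
    finally have "zeta n ^ (n - 1) = cnj (zeta n)" by (simp add: zeta_cis)
    then show ?thesis using z(1) unfolding Rn_def by (metis adjoin_power)
  qed
  have 01: "0 \<in> Rn n" "1 \<in> Rn n" by (simp_all add: Rn_def)
  have "T_gate n $ i $ j \<in> Rn n \<and> dagger (T_gate n) $ i $ j \<in> Rn n" for i j
    using exhaust_2[of i] exhaust_2[of j] z(1) cz 01 by (auto simp: T_gate_def dagger_def)
  then have "T_gate n \<in> carrier (U2 (Rn n))" by (simp add: carrier_U2 T_gate_unitary)
  moreover have "Clifford \<subseteq> carrier (U2 (Rn n))"
    unfolding Clifford_def subset_iff carrier_U2 using sub by blast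
  ultimately show ?thesis by simp
qed

text \<open>Compared on generators: the Clifford group goes into the cube group, which G(4,n)
  contains, and \<open>y_gate\<close> supplies the generator about the y-axis.\<close>

lemma pi_rep_clifford_cyclotomic:
  assumes n: "n > 0" "4 dvd n"
  shows "pi_rep ` clifford_cyclotomic n = carrier (G4 n)"
proof -
  interpret group "SO3 \<real>" by (rule group_SO3_real)
  interpret h: group_hom "U2 (Rn n)" "SO3 \<real>" pi_rep unfolding Rn_def by (rule group_hom_pi_rep)
  let ?g = "{rot_y (pi / 2), rot_z (2 * pi / real n)}"
  have G4: "carrier (G4 n) = generate (SO3 \<real>) ?g" by (simp add: G4_def rotation_subgroup_def)
  have "pi_rep ` clifford_cyclotomic n = generate (SO3 \<real>) (pi_rep ` (Clifford \<union> {T_gate n}))"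
    unfolding clifford_cyclotomic_def using h.generate_img[OF generators_in_U2[OF n]] by simp
  also have "\<dots> = generate (SO3 \<real>) ?g"
  proof
    have "pi_rep ` Clifford \<subseteq> generate (SO3 \<real>) ?g"
      using pi_rep_Clifford_cube cube_group_subset_G4[OF n] by (auto simp: G4)
    then have "pi_rep ` (Clifford \<union> {T_gate n}) \<subseteq> generate (SO3 \<real>) ?g"
      by (auto simp: pi_rep_T_gate intro: generate.incl)
    moreover have "subgroup (generate (SO3 \<real>) ?g) (SO3 \<real>)"
      by (rule generate_is_subgroup) (simp add: rot_y_SO3 rot_z_SO3)
    ultimately show "generate (SO3 \<real>) (pi_rep ` (Clifford \<union> {T_gate n})) \<subseteq> generate (SO3 \<real>) ?g"
      by (rule generate_subgroup_incl)
    have "rot_y (pi / 2) \<in> pi_rep ` Clifford" using y_gate_Clifford pi_rep_y_gate by (metis image_eqI)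
    then have "?g \<subseteq> pi_rep ` (Clifford \<union> {T_gate n})" by (simp add: pi_rep_T_gate)
    then show "generate (SO3 \<real>) ?g \<subseteq> generate (SO3 \<real>) (pi_rep ` (Clifford \<union> {T_gate n}))"
      by (rule mono_generate)
  qed
  finally show ?thesis by (simp add: G4)
qed

text \<open>The quotient is by all scalars of the full unitary group, and these are not assumed to
  lie in the subgroup. Hence the injective map of the first isomorphism theorem is taken on the full
  quotient and restricted to the cosets of the subgroup.\<close>

lemma P_clifford_cyclotomic_iso:
  assumes n: "n > 0" "4 dvd n"
  shows "P_clifford_cyclotomic n \<cong> pi_image n"
proof -
  interpret h: group_hom "U2 (Rn n)" "SO3 \<real>" pi_rep unfolding Rn_def by (rule group_hom_pi_rep)
  let ?K = "kernel (U2 (Rn n)) (SO3 \<real>) pi_rep"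
  let ?Q = "U2 (Rn n) Mod ?K"
  let ?f = "\<lambda>U. the_elem (pi_rep ` U)"
  have K: "U2_scalars (Rn n) = ?K" unfolding Rn_def by (rule kernel_pi_rep[symmetric])
  let ?C = "(\<lambda>g. ?K #>\<^bsub>U2 (Rn n)\<^esub> g) ` clifford_cyclotomic n"
  have P: "P_clifford_cyclotomic n = ?Q\<lparr>carrier := ?C\<rparr>"
    unfolding P_clifford_cyclotomic_def PU2_def K ..
  have cc: "clifford_cyclotomic n \<subseteq> carrier (U2 (Rn n))"
    unfolding clifford_cyclotomic_def using h.G.generate_incl[OF generators_in_U2[OF n]] .
  then have C: "?C \<subseteq> carrier ?Q" by (auto simp: carrier_FactGroup)
  have f: "?f (?K #>\<^bsub>U2 (Rn n)\<^esub> g) = pi_rep g" if "g \<in> clifford_cyclotomic n" for g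
  proof -
    have g: "g \<in> carrier (U2 (Rn n))" using that cc by blast
    have "pi_rep ` (?K #>\<^bsub>U2 (Rn n)\<^esub> g) = {pi_rep g}"
    proof
      show "pi_rep ` (?K #>\<^bsub>U2 (Rn n)\<^esub> g) \<subseteq> {pi_rep g}"
        using h.hom_mult[OF _ g] by (auto simp: kernel_def r_coset_def)
      have "g \<in> ?K #>\<^bsub>U2 (Rn n)\<^esub> g" using h.G.rcos_self[OF g h.subgroup_kernel] .
      then show "{pi_rep g} \<subseteq> pi_rep ` (?K #>\<^bsub>U2 (Rn n)\<^esub> g)" by blast
    qed
    then show ?thesis by simp
  qed
  have fC: "?f ` ?C = pi_rep ` clifford_cyclotomic n" using f by (simp add: image_image)
  have "?f \<in> hom (P_clifford_cyclotomic n) (pi_image n)"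
  proof (rule homI)
    fix U assume U: "U \<in> carrier (P_clifford_cyclotomic n)"
    then show "?f U \<in> carrier (pi_image n)" using fC by (auto simp: P pi_image_def)
    fix V assume V: "V \<in> carrier (P_clifford_cyclotomic n)"
    show "?f (U \<otimes>\<^bsub>P_clifford_cyclotomic n\<^esub> V) = ?f U \<otimes>\<^bsub>pi_image n\<^esub> ?f V"
      using hom_mult[OF h.FactGroup_hom, of U V] U V C by (auto simp: P pi_image_def SO3_def)
  qed
  moreover have "inj_on ?f (carrier (P_clifford_cyclotomic n))"
    using inj_on_subset[OF h.FactGroup_inj_on C] by (simp add: P)
  moreover have "?f ` carrier (P_clifford_cyclotomic n) = carrier (pi_image n)"
    using fC by (simp add: P pi_image_def)
  ultimately show ?thesis by (intro is_isoI) (simp add: iso_def bij_betw_def)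
qed

theorem theorem5p1:
  fixes n :: nat
  assumes "n \<ge> 8" and "4 dvd n"
  shows "P_clifford_cyclotomic n \<cong> pi_image n
    \<and> pi_image n = G4 n
    \<and> G4 n \<cong> amalg_product cube_group (dihedral_rot n) (cube_dihedral_inter n)
                 (\<lambda>A. A) (\<lambda>A. A)"
proof (intro conjI)
  have n: "n > 0" "4 dvd n" using assms by simp_all
  show "P_clifford_cyclotomic n \<cong> pi_image n" by (rule P_clifford_cyclotomic_iso[OF n])
  show "pi_image n = G4 n"
    \<comment> \<open>An equality of records: multiplication and unit of \<open>SO3\<close> do not
      depend on the ring, and both carriers have been replaced.\<close>
    using pi_rep_clifford_cyclotomic[OF n]
    by (simp add: pi_image_def G4_def rotation_subgroup_def SO3_def)
  show "G4 n \<cong> amalg_product cube_group (dihedral_rot n) (cube_dihedral_inter n) (\<lambda>A. A) (\<lambda>A. A)"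
    by (rule G4_iso_amalg_product[OF n])
qed

end
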